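(* Every Blaschke product $B\in\mathcal{H}_{SC}$ has a factor which is a Blaschke product that is both interpolating and one-component.
   Context: $\mathbb{D}$ is the open unit disk in $\mathbb{C}$ and $\partial\mathbb{D}$ the unit circle. The pseudo-hyperbolic distance is $\rho(z,w)=\left|\frac{z-w}{1-\overline{z}w}\right|$ for $z,w\in\mathbb{D}$. $H^\infty$ is the algebra of bounded analytic functions on $\mathbb{D}$. An inner function is an element of $H^\infty$ with unimodular radial limits almost everywhere on $\partial\mathbb{D}$. A Blaschke product is an inner function $B(z)=\lambda z^{m}\prod_{n}\frac{|z_n|}{z_n}\frac{z_n-z}{1-\overline{z_n}z}$ with $m\ge 0$ an integer, $|\lambda|=1$, $z_n\in\mathbb{D}\setminus\{0\}$ and $\sum_n(1-|z_n|)<\infty$. Zeros are listed with multiplicity. A Blaschke product $b$ is a factor of $B$ if $B=bg$ for some Blaschke product $g$. A Blaschke product with zero sequence $\{z_n\}_{n=1}^\infty$ (an infinite sequence) is interpolating if for every bounded sequence $\{w_n\}_{n=1}^\infty$ of complex numbers there is $f\in H^\infty$ with $f(z_n)=w_n$ for every $n\in\mathbb{N}$. An inner function $u$ is one-component if there is $\eta\in(0,1)$ such that the level set $\{z\in\mathbb{D}:|u(z)|<\eta\}$ is connected. Strip cone: let $\theta\in(0,\pi)$, $\xi\in\partial\mathbb{D}$, and let $T_1,T_2$ be nonzero real numbers. For $i=1,2$ let $J_i$ be the arc inside $\mathbb{D}$ of the circle $|z-(1-T_ie^{\mathbf{i}\theta})\xi|=|T_i|$, and let $\xi_i$ be the intersection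 point of this circle with $\partial\mathbb{D}$ other than $\xi$. $SC(\xi,\theta,T_1,T_2)$ is the region in $\mathbb{D}$ bounded by $J_1$, $J_2$ and the arc of $\partial\mathbb{D}$ from $\xi_1$ to $\xi_2$ not containing $\xi$ (points of $J_1,J_2$ included). Equivalently, it is the set of $z\in\mathbb{D}$ such that $\mathrm{Re}\left(e^{\mathbf{i}\theta}\frac{\xi}{\xi-z}\right)$ lies between $\frac1{2T_1}$ and $\frac1{2T_2}$ (inclusive). If $T_1=T_2$ it is the arc $J_1=J_2$. In particular, if $T_1$ and $T_2$ are infinity, it is the segment $(-1,1)$. $\mathcal{H}_{SC}$ is the family of all Blaschke products $B$ (with infinitely many zeros) such that: (i) the zeros $\{z_n\}_{n=1}^\infty$ of $B$ lie in some strip cone $SC(\xi,\theta,T_1,T_2)$; (ii) $|\xi-z_n|$ is non-increasing in $n$ and tends to $0$; (iii) there is a positive number $\delta<1$ with $\rho(z_n,z_{n+1})\le\delta$ for all $n\in\mathbb{N}$. *)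

theory Defs
  imports "HOL-Complex_Analysis.Complex_Analysis"
begin

text \<open>Functions on the open unit disk are functions of type \<^typ>\<open>complex \<Rightarrow> complex\<close> of which only
  the values on \<^term>\<open>ball 0 1 :: complex set\<close> matter.\<close>

abbreviation unit_disk :: "complex set" where
  "unit_disk \<equiv> ball 0 1"

definition pseudo_hyperbolic_dist :: "complex \<Rightarrow> complex \<Rightarrow> real" where
  "pseudo_hyperbolic_dist z w = norm ((z - w) / (1 - cnj z * w))"

definition H_infinity :: "(complex \<Rightarrow> complex) set" where
  "H_infinity = {f. f holomorphic_on unit_disk \<and> bounded (f ` unit_disk)}"

definition inner_function :: "(complex \<Rightarrow> complex) \<Rightarrow> bool" where
  "inner_function u \<longleftrightarrow> u \<in> H_infinity \<and>
     (AE t in lebesgue_on {0..2*pi}.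
        \<exists>l. norm l = 1 \<and> ((\<lambda>r. u (of_real r * cis t)) \<longlongrightarrow> l) (at_left 1))"

definition blaschke_term :: "complex \<Rightarrow> complex \<Rightarrow> complex" where
  "blaschke_term a z = of_real (norm a) / a * ((a - z) / (1 - cnj a * z))"

text \<open>The index set \<open>I\<close> ranges over all sets of natural numbers, so that empty, finite and
  infinite products are covered alike.\<close>

definition blaschke_product :: "(complex \<Rightarrow> complex) \<Rightarrow> bool" where
  "blaschke_product B \<longleftrightarrow> inner_function B \<and>
     (\<exists>c m (I :: nat set) a. norm c = 1 \<and> a ` I \<subseteq> unit_disk - {0} \<and>
        (\<lambda>n. 1 - norm (a n)) summable_on I \<and>
        (\<forall>z\<in>unit_disk. B z = c * z ^ m * (\<Prod>n. if n \<in> I then blaschke_term (a n) z else 1)))"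

definition blaschke_factor :: "(complex \<Rightarrow> complex) \<Rightarrow> (complex \<Rightarrow> complex) \<Rightarrow> bool" where
  "blaschke_factor b B \<longleftrightarrow> blaschke_product b \<and>
     (\<exists>g. blaschke_product g \<and> (\<forall>z\<in>unit_disk. B z = b z * g z))"

text \<open>\<open>z\<close> is an infinite sequence listing all zeros of \<open>B\<close> in the disk (including a zero at the
  origin), each as often as its multiplicity. The order \<^const>\<open>zorder\<close> is 0 at points that are
  not zeros. Finiteness is required because \<^const>\<open>card\<close> is 0 on infinite sets.\<close>

definition zero_sequence :: "(complex \<Rightarrow> complex) \<Rightarrow> (nat \<Rightarrow> complex) \<Rightarrow> bool" where
  "zero_sequence B z \<longleftrightarrow> range z \<subseteq> unit_disk \<and>
     (\<forall>a\<in>unit_disk. finite {n. z n = a} \<and> int (card {n. z n = a}) = zorder B a)"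

text \<open>The interpolation property does not depend on the chosen enumeration of the zeros.\<close>

definition interpolating_blaschke_product :: "(complex \<Rightarrow> complex) \<Rightarrow> bool" where
  "interpolating_blaschke_product B \<longleftrightarrow> blaschke_product B \<and>
     (\<exists>z. zero_sequence B z \<and>
        (\<forall>w :: nat \<Rightarrow> complex. bounded (range w) \<longrightarrow> (\<exists>f\<in>H_infinity. \<forall>n. f (z n) = w n)))"

definition one_component :: "(complex \<Rightarrow> complex) \<Rightarrow> bool" where
  "one_component u \<longleftrightarrow> inner_function u \<and>
     (\<exists>\<eta>. 0 < \<eta> \<and> \<eta> < 1 \<and> connected {z \<in> unit_disk. norm (u z) < \<eta>})"

text \<open>The strip cone between the two circles through \<open>\<xi>\<close> with centres \<open>(1 - T\<^sub>i e\<^sup>i\<^sup>\<theta>) \<xi>\<close> and radii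
  \<open>\<bar>T\<^sub>i\<bar>\<close>. Extended real parameters allow infinite \<open>T\<^sub>i\<close>, for which the circle is a line through
  \<open>\<xi>\<close> and \<open>1 / (2 T\<^sub>i) = 0\<close>. The two lemmas below identify the bounding arcs with these curves.\<close>

definition half_curvature :: "ereal \<Rightarrow> real" where
  "half_curvature T = real_of_ereal (1 / (2 * T))"

definition strip_cone :: "complex \<Rightarrow> real \<Rightarrow> ereal \<Rightarrow> ereal \<Rightarrow> complex set" where
  "strip_cone \<xi> \<theta> T\<^sub>1 T\<^sub>2 =
     {z \<in> unit_disk. Re (cis \<theta> * (\<xi> / (\<xi> - z)))
        \<in> {min (half_curvature T\<^sub>1) (half_curvature T\<^sub>2)..max (half_curvature T\<^sub>1) (half_curvature T\<^sub>2)}}"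

lemma half_curvature_simps [simp]:
  "T \<noteq> 0 \<Longrightarrow> half_curvature (ereal T) = 1 / (2 * T)"
  "half_curvature \<infinity> = 0" "half_curvature (-\<infinity>) = 0"
  by (auto simp: half_curvature_def one_ereal_def numeral_eq_ereal divide_ereal_def field_simps)

lemma strip_cone_arc:
  assumes "norm \<xi> = 1" "T \<noteq> 0"
  shows "strip_cone \<xi> \<theta> (ereal T) (ereal T) =
    {z \<in> unit_disk. norm (z - (1 - of_real T * cis \<theta>) * \<xi>) = \<bar>T\<bar>}"
proof -
  have "Re (cis \<theta> * (\<xi> / (\<xi> - z))) = 1 / (2 * T) \<longleftrightarrow>
      norm (z - (1 - of_real T * cis \<theta>) * \<xi>) = \<bar>T\<bar>" if "z \<in> unit_disk" for z
  proof -
    define u where "u = \<xi> - z"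
    define e where "e = cis \<theta> * \<xi>"
    have u: "u \<noteq> 0" using that assms by (auto simp: u_def)
    have e: "(norm e)\<^sup>2 = 1" using assms by (simp add: e_def norm_mult)
    have eq: "z - (1 - of_real T * cis \<theta>) * \<xi> = of_real T * e - u"
      by (simp add: u_def e_def algebra_simps)
    have "norm (of_real T * e - u) = \<bar>T\<bar> \<longleftrightarrow> (norm (of_real T * e - u))\<^sup>2 = T\<^sup>2"
      by (metis abs_norm_cancel power2_eq_iff_nonneg abs_ge_zero norm_ge_zero power2_abs)
    also have "(norm (of_real T * e - u))\<^sup>2 = T\<^sup>2 * (norm e)\<^sup>2 + (norm u)\<^sup>2 - 2 * T * Re (e * cnj u)"
      unfolding cmod_power2 by (simp add: power2_eq_square algebra_simps)
    also have "\<dots> = T\<^sup>2 \<longleftrightarrow> (norm u)\<^sup>2 = 2 * T * Re (e * cnj u)"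
      by (simp add: e algebra_simps)
    also have "\<dots> \<longleftrightarrow> Re (e * cnj u) / (norm u)\<^sup>2 = 1 / (2 * T)"
      using assms u by (auto simp: field_simps)
    also have "Re (e * cnj u) / (norm u)\<^sup>2 = Re (e / u)"
      by (simp add: complex_div_cnj[of e u] Re_divide_of_real flip: of_real_power)
    finally show ?thesis by (simp add: eq) (simp add: u_def e_def)
  qed
  then show ?thesis
    using assms by (auto simp: strip_cone_def)
qed

lemma strip_cone_segment: "strip_cone 1 (pi/2) \<infinity> \<infinity> = of_real ` {-1<..<1}"
proof -
  have "Re (cis (pi/2) * (1 / (1 - z))) = 0 \<longleftrightarrow> z \<in> \<real>" if "z \<in> unit_disk" for z :: complex
  proof -
    have "z \<noteq> 1" using that by auto
    then have "(norm (1 - z))\<^sup>2 \<noteq> 0" by simp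
    then have nz: "(Re (1 - z))\<^sup>2 + (Im (1 - z))\<^sup>2 \<noteq> 0" unfolding cmod_power2 .
    have "Re (cis (pi/2) * (1 / (1 - z))) = Im (1 - z) / ((Re (1 - z))\<^sup>2 + (Im (1 - z))\<^sup>2)"
      by (simp add: Re_divide)
    then show ?thesis
      using nz by (auto simp: complex_is_Real_iff)
  qed
  then have "strip_cone 1 (pi/2) \<infinity> \<infinity> = unit_disk \<inter> \<real>"
    by (auto simp: strip_cone_def)
  also have "\<dots> = of_real ` {-1<..<1}"
    by (auto simp: Reals_def abs_less_iff)
  finally show ?thesis .
qed

definition H_SC :: "(complex \<Rightarrow> complex) set" where
  "H_SC = {B. blaschke_product B \<and>
     (\<exists>z \<xi> \<theta> T\<^sub>1 T\<^sub>2 \<delta>. zero_sequence B z \<and>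
        norm \<xi> = 1 \<and> 0 < \<theta> \<and> \<theta> < pi \<and> T\<^sub>1 \<noteq> 0 \<and> T\<^sub>2 \<noteq> 0 \<and>
        range z \<subseteq> strip_cone \<xi> \<theta> T\<^sub>1 T\<^sub>2 \<and>
        decseq (\<lambda>n. norm (\<xi> - z n)) \<and> (\<lambda>n. norm (\<xi> - z n)) \<longlonglongrightarrow> 0 \<and>
        0 < \<delta> \<and> \<delta> < 1 \<and> (\<forall>n. pseudo_hyperbolic_dist (z n) (z (Suc n)) \<le> \<delta>))}"

end

theory Submission imports Defs begin

text \<open>Write \<open>d\<^sub>n = \<bar>\<xi> - z\<^sub>n\<bar>\<close>. Eventually the zeros approach \<open>\<xi>\<close> nontangentially, and the bound on
  consecutive pseudo-hyperbolic distances bounds the ratios \<open>d\<^sub>n / d\<^sub>n\<^sub>+\<^sub>1\<close>. Hence there is a subsequence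
  along which \<open>d\<close> decays geometrically, by factors between 17 and a constant, while consecutive terms
  keep a pseudo-hyperbolic distance bounded away from 1. Let \<open>b\<close> be the Blaschke product over this
  subsequence.

  Geometric decay gives interpolation: with \<open>u = 1 - cnj \<xi> z\<close> the peak functions
  \<open>4 d\<^sub>k u / (u + d\<^sub>k)\<^sup>2\<close>, normalised at \<open>z\<^sub>k\<close>, have uniformly bounded absolute sum, and their values at
  the nodes form an infinite matrix so close to the identity that it is invertible on bounded sequences.

  The distance bound gives one component: if \<open>\<eta>\<close> exceeds all consecutive distances, the discs
  \<open>\<rho>(z, z\<^sub>k) < \<eta>\<close> form a chain inside the level set of each partial product, and by the maximum modulus
  principle for the reciprocal every component of that level set contains a zero. The level set of \<open>b\<close>
  is the increasing union of those of the partial products.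

  Since the zeros accumulate only at \<open>\<xi>\<close>, the products converge locally uniformly on the closed disk
  without \<open>\<xi>\<close>; this makes both \<open>b\<close> and the cofactor inner.\<close>

subsection \<open>Blaschke products over subsets of an index set\<close>

text \<open>The index set is a parameter so that a factor of the product arises by shrinking
  \<open>I\<close> with the sequence \<open>a\<close> fixed. The body is literally the infinite
  product in \<open>blaschke_product\<close>.\<close>

definition blaschke_prod :: "nat set \<Rightarrow> (nat \<Rightarrow> complex) \<Rightarrow> complex \<Rightarrow> complex" where
  "blaschke_prod I a z = (\<Prod>n. if n \<in> I then blaschke_term (a n) z else 1)"

definition blaschke_zeros :: "nat set \<Rightarrow> (nat \<Rightarrow> complex) \<Rightarrow> bool" where
  "blaschke_zeros I a \<longleftrightarrow> a ` I \<subseteq> unit_disk - {0} \<and> (\<lambda>n. 1 - norm (a n)) summable_on I"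

lemma blaschke_zerosD:
  assumes "blaschke_zeros I a" "n \<in> I"
  shows "a n \<noteq> 0" "norm (a n) < 1"
  using assms by (auto simp: blaschke_zeros_def)

lemma blaschke_zeros_subset:
  "blaschke_zeros I a \<Longrightarrow> J \<subseteq> I \<Longrightarrow> blaschke_zeros J a"
  unfolding blaschke_zeros_def using summable_on_subset_banach by fastforce

section \<open>Estimates for a single Blaschke factor\<close>

lemma one_minus_mult_nz:
  fixes a z :: complex
  assumes "norm a < 1" "norm z \<le> 1"
  shows "1 - cnj a * z \<noteq> 0"
proof
  assume "1 - cnj a * z = 0"
  then have "norm (cnj a * z) = 1"
    by (metis eq_iff_diff_eq_0 norm_one)
  moreover have "norm (cnj a * z) \<le> norm a * 1"
    unfolding norm_mult using assms(2) by (intro mult_mono) auto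
  ultimately show False using assms by simp
qed

lemma one_minus_mult_ge:
  fixes a z :: complex
  assumes "norm z \<le> 1"
  shows "1 - norm a \<le> norm (1 - cnj a * z)"
proof -
  have "norm (cnj a * z) \<le> norm a * 1"
    unfolding norm_mult using assms by (intro mult_mono) auto
  then show ?thesis using norm_triangle_ineq2[of 1 "cnj a * z"] by simp
qed

text \<open>A polynomial identity, from which the formula for \<open>1 - \<rho>\<^sup>2\<close> and
  the modulus of a Blaschke factor inside and on the circle are read off.\<close>

lemma norm_moebius_identity:
  "(norm (1 - cnj a * z))\<^sup>2 - (norm (a - z))\<^sup>2 = (1 - (norm a)\<^sup>2) * (1 - (norm z)\<^sup>2)"
  unfolding cmod_power2 by (simp add: power2_eq_square algebra_simps)

lemma norm_blaschke_term:
  assumes "a \<noteq> 0"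
  shows "norm (blaschke_term a z) = pseudo_hyperbolic_dist a z"
  using assms by (simp add: blaschke_term_def pseudo_hyperbolic_dist_def norm_mult norm_divide)

lemma pseudo_hyperbolic_sq:
  assumes "norm a < 1" "norm z \<le> 1"
  shows "1 - (pseudo_hyperbolic_dist a z)\<^sup>2 =
    (1 - (norm a)\<^sup>2) * (1 - (norm z)\<^sup>2) / (norm (1 - cnj a * z))\<^sup>2"
proof -
  have "(norm (1 - cnj a * z))\<^sup>2 \<noteq> 0" using one_minus_mult_nz[OF assms] by simp
  then show ?thesis
    by (simp add: pseudo_hyperbolic_dist_def norm_divide power_divide field_simps
        flip: norm_moebius_identity)
qed

lemma pseudo_hyperbolic_le_1:
  assumes "norm a < 1" "norm z \<le> 1"
  shows "pseudo_hyperbolic_dist a z \<le> 1"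
proof -
  have "0 \<le> (1 - (norm a)\<^sup>2) * (1 - (norm z)\<^sup>2) / (norm (1 - cnj a * z))\<^sup>2"
    using assms by (intro divide_nonneg_nonneg mult_nonneg_nonneg) (auto simp: power_le_one)
  then have "(pseudo_hyperbolic_dist a z)\<^sup>2 \<le> 1"
    using pseudo_hyperbolic_sq[OF assms] by linarith
  then show ?thesis by (simp add: power2_le_imp_le)
qed

lemma pseudo_hyperbolic_eq_1:
  assumes "norm a < 1" "norm z = 1"
  shows "pseudo_hyperbolic_dist a z = 1"
proof -
  have "(pseudo_hyperbolic_dist a z)\<^sup>2 = 1\<^sup>2"
    using pseudo_hyperbolic_sq[of a z] assms by simp
  then show ?thesis
    by (metis norm_ge_zero one_neq_neg_one pseudo_hyperbolic_dist_def power2_eq_iff_nonneg zero_le_one)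
qed

lemma blaschke_term_0_iff:
  assumes "a \<noteq> 0" "norm a < 1" "norm z \<le> 1"
  shows "blaschke_term a z = 0 \<longleftrightarrow> z = a"
  using assms one_minus_mult_nz[of a z] by (auto simp: blaschke_term_def)

lemma holomorphic_blaschke_term:
  assumes "norm a < 1" shows "blaschke_term a holomorphic_on unit_disk"
  unfolding blaschke_term_def
  using one_minus_mult_nz[OF assms] by (intro holomorphic_intros) auto

lemma continuous_blaschke_term:
  assumes "norm a < 1" "X \<subseteq> cball 0 1" shows "continuous_on X (blaschke_term a)"
  unfolding blaschke_term_def
  using one_minus_mult_nz[OF assms(1)] assms(2) by (intro continuous_intros) auto

text \<open>Over the common denominator the difference factors through \<open>1 - norm a\<close>, so
  the Blaschke condition makes the deviations from 1 summable. The denominator is kept because it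
  can stay bounded below even at boundary points.\<close>

lemma blaschke_term_minus_1:
  assumes a: "a \<noteq> 0" "norm a < 1" and z: "norm z \<le> 1"
  shows "norm (blaschke_term a z - 1) \<le> 2 * (1 - norm a) / norm (1 - cnj a * z)"
proof -
  have nz: "1 - cnj a * z \<noteq> 0" using one_minus_mult_nz a z by blast
  have *: "of_real (norm a) * (a - z) - a * (1 - cnj a * z) =
     - ((1 - of_real (norm a)) * (a + of_real (norm a) * z))"
    using complex_norm_square[of a] by (simp add: algebra_simps power2_eq_square)
  have "blaschke_term a z - 1 =
     - ((1 - of_real (norm a)) * (a + of_real (norm a) * z)) / (a * (1 - cnj a * z))"
    unfolding *[symmetric] using a nz by (simp add: blaschke_term_def field_simps)
  then have "norm (blaschke_term a z - 1) =
     norm (of_real (1 - norm a) :: complex) * norm (a + of_real (norm a) * z) / (norm a * norm (1 - cnj a * z))"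
    by (simp add: norm_divide norm_mult)
  also have "\<dots> \<le> (1 - norm a) * (norm a * 2) / (norm a * norm (1 - cnj a * z))"
  proof (intro divide_right_mono mult_mono)
    have "norm (of_real (norm a) * z) \<le> norm a * 1"
      unfolding norm_mult using z by (intro mult_mono) auto
    then show "norm (a + of_real (norm a) * z) \<le> norm a * 2"
      using norm_triangle_ineq[of a "of_real (norm a) * z"] by linarith
  qed (use a in \<open>auto simp del: of_real_diff\<close>)
  also have "\<dots> = 2 * (1 - norm a) / norm (1 - cnj a * z)" using a by simp
  finally show ?thesis .
qed

section \<open>Convergence and multiplicativity of Blaschke products\<close>

text \<open>The Weierstrass test applies to the deviations of the factors from 1. Since only the
  bound \<open>\<kappa>\<close> on the denominators enters, \<open>X\<close> may reach the unit
  circle, which the radial limits require later.\<close>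

lemma uniform_limit_blaschke_prod:
  assumes I: "blaschke_zeros I a" and X: "X \<subseteq> cball 0 1" "compact X"
    and \<kappa>: "\<kappa> > 0" "\<And>n z. n \<in> I \<Longrightarrow> z \<in> X \<Longrightarrow> \<kappa> \<le> norm (1 - cnj (a n) * z)"
  shows "uniform_limit X (\<lambda>N z. \<Prod>n<N. if n \<in> I then blaschke_term (a n) z else 1)
           (blaschke_prod I a) sequentially"
    and "z \<in> X \<Longrightarrow> convergent_prod (\<lambda>n. if n \<in> I then blaschke_term (a n) z else 1)"
proof -
  let ?f = "\<lambda>n z. if n \<in> I then blaschke_term (a n) z else 1"
  define M where "M n = (if n \<in> I then 2 * (1 - norm (a n)) / \<kappa> else 0)" for n
  have "(\<lambda>n. 1 - norm (a n)) summable_on I" using I by (simp add: blaschke_zeros_def)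
  then have "(\<lambda>n. if n \<in> I then 1 - norm (a n) else 0) summable_on UNIV"
    by (rule summable_on_cong_neutral[THEN iffD1, rotated -1]) auto
  then have "summable (\<lambda>n. if n \<in> I then 1 - norm (a n) else 0)"
    by (rule summable_on_imp_summable)
  then have "summable (\<lambda>n. (2 / \<kappa>) * (if n \<in> I then 1 - norm (a n) else 0))"
    by (rule summable_mult)
  moreover have "(\<lambda>n. (2 / \<kappa>) * (if n \<in> I then 1 - norm (a n) else 0)) = M"
    by (auto simp: M_def)
  ultimately have M: "summable M" by metis
  have le: "norm (?f n z - 1) \<le> M n" if "z \<in> X" for n z
  proof (cases "n \<in> I")
    case True
    have "norm (blaschke_term (a n) z - 1) \<le> 2 * (1 - norm (a n)) / norm (1 - cnj (a n) * z)"
      using blaschke_zerosD[OF I True] that X by (intro blaschke_term_minus_1) auto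
    also have "\<dots> \<le> 2 * (1 - norm (a n)) / \<kappa>"
      using \<kappa>(1) \<kappa>(2)[OF True that] blaschke_zerosD(2)[OF I True] by (intro frac_le) auto
    finally show ?thesis using True by (simp add: M_def)
  qed (simp add: M_def)
  have cont: "continuous_on X (?f n)" for n
    using blaschke_zerosD[OF I] X by (cases "n \<in> I") (auto intro!: continuous_blaschke_term)
  have "uniformly_convergent_on X (\<lambda>N z. \<Sum>n<N. norm (?f n z - 1))"
    using le M by (intro Weierstrass_m_test'[of X _ M]) auto
  then have "uniformly_convergent_on X (\<lambda>N z. \<Prod>n<N. ?f n z)"
    using cont X by (intro uniformly_convergent_on_prod') auto
  moreover have conv: "convergent_prod (\<lambda>n. ?f n z)" if "z \<in> X" for z
  proof (rule abs_convergent_prod_imp_convergent_prod, rule summable_imp_abs_convergent_prod)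
    show "summable (\<lambda>n. norm (?f n z - 1))"
      by (rule summable_comparison_test'[OF M]) (simp only: real_norm_def abs_norm_cancel le[OF that])
  qed
  ultimately have lim: "uniform_limit X (\<lambda>N z. \<Prod>n<N. ?f n z) (\<lambda>z. lim (\<lambda>N. \<Prod>n<N. ?f n z)) sequentially"
    by (simp only: uniformly_convergent_uniform_limit_iff)
  have eq: "blaschke_prod I a z = lim (\<lambda>N. \<Prod>n<N. ?f n z)" if "z \<in> X" for z
    using convergent_prod_LIMSEQ[OF conv[OF that]]
    unfolding blaschke_prod_def by (intro limI[symmetric]) (simp only: LIMSEQ_lessThan_iff_atMost)
  show "uniform_limit X (\<lambda>N z. \<Prod>n<N. ?f n z) (blaschke_prod I a) sequentially"
    by (rule uniform_limit_cong'[OF refl eq, THEN iffD2, OF _ lim])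
  show "z \<in> X \<Longrightarrow> convergent_prod (\<lambda>n. ?f n z)" by (rule conv)
qed

lemma blaschke_disk_bound:
  assumes "blaschke_zeros I a" "n \<in> I" "norm z \<le> r" "r < 1"
  shows "1 - r \<le> norm (1 - cnj (a n) * z)"
proof -
  have "norm (cnj (a n) * z) \<le> 1 * r"
    unfolding norm_mult using assms blaschke_zerosD[OF assms(1,2)] by (intro mult_mono) auto
  then show ?thesis using norm_triangle_ineq2[of 1 "cnj (a n) * z"] by simp
qed

lemma convergent_blaschke_prod:
  assumes I: "blaschke_zeros I a" and z: "z \<in> unit_disk"
  shows "convergent_prod (\<lambda>n. if n \<in> I then blaschke_term (a n) z else 1)"
  using z blaschke_disk_bound[OF I, of _ z "norm z"]
  by (intro uniform_limit_blaschke_prod(2)[OF I, of "{z}" "1 - norm z"]) auto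

lemma blaschke_prod_LIMSEQ:
  assumes "blaschke_zeros I a" "z \<in> unit_disk"
  shows "(\<lambda>N. \<Prod>n<N. if n \<in> I then blaschke_term (a n) z else 1) \<longlonglongrightarrow> blaschke_prod I a z"
  using convergent_prod_LIMSEQ[OF convergent_blaschke_prod[OF assms]]
  unfolding blaschke_prod_def by (simp add: LIMSEQ_lessThan_iff_atMost)

lemma holomorphic_blaschke_prod:
  assumes I: "blaschke_zeros I a"
  shows "blaschke_prod I a holomorphic_on unit_disk"
proof (rule holomorphic_uniform_sequence)
  show "(\<lambda>z. \<Prod>n<N. if n \<in> I then blaschke_term (a n) z else 1) holomorphic_on unit_disk" for N
  proof (intro holomorphic_intros)
    fix n assume "n \<in> {..<N}"
    show "(\<lambda>z. if n \<in> I then blaschke_term (a n) z else 1) holomorphic_on unit_disk"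
      using holomorphic_blaschke_term blaschke_zerosD[OF I, of n] by (cases "n \<in> I") auto
  qed
  fix x :: complex assume x: "x \<in> unit_disk"
  define d where "d = (1 - norm x) / 2"
  have nd: "norm y \<le> norm x + d" if "y \<in> cball x d" for y
    using that norm_triangle_sub[of y x] by (auto simp: dist_norm norm_minus_commute)
  have d: "d > 0" "norm x + d < 1" using x by (auto simp: d_def field_simps)
  have sub: "cball x d \<subseteq> unit_disk"
    using nd d by fastforce
  have "uniform_limit (cball x d) (\<lambda>N z. \<Prod>n<N. if n \<in> I then blaschke_term (a n) z else 1)
           (blaschke_prod I a) sequentially"
    using d nd sub blaschke_disk_bound[OF I]
    by (intro uniform_limit_blaschke_prod(1)[OF I, where \<kappa> = "1 - (norm x + d)"]) fastforce+
  with sub d show "\<exists>d. 0 < d \<and> cball x d \<subseteq> unit_disk \<and> uniform_limit (cball x d)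
     (\<lambda>N z. \<Prod>n<N. if n \<in> I then blaschke_term (a n) z else 1) (blaschke_prod I a) sequentially"
    by blast
qed auto

text \<open>A product that converges in the sense of \<open>convergent_prod\<close> vanishes only if
  one of its factors does.\<close>

lemma blaschke_prod_nonzero:
  assumes "blaschke_zeros I a" "z \<in> unit_disk" "z \<notin> a ` I"
  shows "blaschke_prod I a z \<noteq> 0"
  unfolding blaschke_prod_def
  using convergent_blaschke_prod[OF assms(1,2)] assms(2,3) blaschke_zerosD[OF assms(1)]
  by (intro prodinf_nonzero) (auto simp: blaschke_term_0_iff)

lemma blaschke_prod_Un:
  assumes "blaschke_zeros (I \<union> J) a" "I \<inter> J = {}" "z \<in> unit_disk"
  shows "blaschke_prod (I \<union> J) a z = blaschke_prod I a z * blaschke_prod J a z"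
proof -
  have "blaschke_zeros I a" "blaschke_zeros J a"
    using assms(1) blaschke_zeros_subset by blast+
  then have "blaschke_prod I a z * blaschke_prod J a z =
     (\<Prod>n. (if n \<in> I then blaschke_term (a n) z else 1) * (if n \<in> J then blaschke_term (a n) z else 1))"
    unfolding blaschke_prod_def using assms(3) by (intro prodinf_mult convergent_blaschke_prod)
  also have "\<dots> = blaschke_prod (I \<union> J) a z"
    unfolding blaschke_prod_def using assms(2) by (intro prodinf_cong) auto
  finally show ?thesis by simp
qed

lemma blaschke_prod_finite:
  assumes "finite I"
  shows "blaschke_prod I a z = (\<Prod>n\<in>I. blaschke_term (a n) z)"
  unfolding blaschke_prod_def by (subst prodinf_finite[OF assms]) auto

lemma norm_partial_blaschke_le_1:
  assumes "blaschke_zeros I a" "norm z \<le> 1"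
  shows "norm (\<Prod>n\<in>F. if n \<in> I then blaschke_term (a n) z else 1) \<le> 1"
  unfolding prod_norm[symmetric]
  using assms(2) blaschke_zerosD[OF assms(1)]
  by (intro prod_le_1) (auto simp: norm_blaschke_term pseudo_hyperbolic_le_1)

lemma norm_blaschke_prod_le_1:
  assumes "blaschke_zeros I a" "z \<in> unit_disk"
  shows "norm (blaschke_prod I a z) \<le> 1"
proof (rule Lim_norm_ubound[OF _ blaschke_prod_LIMSEQ[OF assms]])
  show "\<forall>\<^sub>F N in sequentially. norm (\<Prod>n<N. if n \<in> I then blaschke_term (a n) z else 1) \<le> 1"
    using norm_partial_blaschke_le_1[OF assms(1)] assms(2) by auto
qed simp

text \<open>The additional factors form a product of modulus at most 1. Hence level sets grow with
  the index set.\<close>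

lemma norm_blaschke_prod_antimono:
  assumes "blaschke_zeros I a" "z \<in> unit_disk" "J \<subseteq> I"
  shows "norm (blaschke_prod I a z) \<le> norm (blaschke_prod J a z)"
proof -
  have "I = J \<union> (I - J)" using assms by auto
  then have "blaschke_prod I a z = blaschke_prod J a z * blaschke_prod (I - J) a z"
    using blaschke_prod_Un[of J "I - J"] assms by auto
  moreover have "norm (blaschke_prod (I - J) a z) \<le> 1"
    using assms blaschke_zeros_subset[of I a "I - J"] by (intro norm_blaschke_prod_le_1) auto
  ultimately show ?thesis by (simp add: norm_mult mult_left_le)
qed

text \<open>Otherwise the positive constant \<open>1 - norm \<alpha>\<close> would be summable over
  an infinite set.\<close>

lemma finite_blaschke_zeros_eq:
  assumes "blaschke_zeros I a" "norm \<alpha> < 1"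
  shows "finite {n\<in>I. a n = \<alpha>}"
proof (rule ccontr)
  assume inf: "infinite {n\<in>I. a n = \<alpha>}"
  have "(\<lambda>n. 1 - norm (a n)) summable_on {n\<in>I. a n = \<alpha>}"
    using assms(1) by (auto simp: blaschke_zeros_def intro: summable_on_subset_banach)
  then have "(\<lambda>n. 1 - norm \<alpha>) summable_on {n\<in>I. a n = \<alpha>}"
    by (rule summable_on_cong[THEN iffD1, rotated]) auto
  then show False using infsum_diverge_constant[OF inf, of "1 - norm \<alpha>"] assms(2) by simp
qed

subsection \<open>Connected level sets\<close>

text \<open>By the maximum modulus principle for \<open>1 / f\<close>, every component of the level set contains a
  zero of \<open>f\<close>.\<close>

lemma connected_level_set:
  fixes f :: "complex \<Rightarrow> complex"
  assumes cont: "continuous_on (cball 0 1) f" and hol: "f holomorphic_on unit_disk"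
    and unimod: "\<And>z. norm z = 1 \<Longrightarrow> norm (f z) = 1"
    and \<eta>: "0 < \<eta>" "\<eta> < 1"
    and C: "connected C" "C \<subseteq> {z \<in> unit_disk. norm (f z) < \<eta>}"
    and zeros: "{z \<in> unit_disk. f z = 0} \<subseteq> C"
  shows "connected {z \<in> unit_disk. norm (f z) < \<eta>}"
proof -
  define S where "S = {z \<in> unit_disk. norm (f z) < \<eta>}"
  have "open (unit_disk \<inter> f -` ball 0 \<eta>)"
    using hol holomorphic_on_imp_continuous_on by (intro continuous_open_preimage) auto
  also have "unit_disk \<inter> f -` ball 0 \<eta> = S" by (auto simp: S_def)
  finally have S: "open S" .
  have zero: "U \<inter> C \<noteq> {}" if U: "U \<in> components S" for U
  proof
    assume UC: "U \<inter> C = {}"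
    have open_U: "open U" using open_components S U by blast
    have US: "U \<subseteq> S" using U in_components_subset by blast
    then have Ucb: "closure U \<subseteq> cball 0 1"
      by (intro closure_minimal) (auto simp: S_def)
    \<comment> \<open>A frontier point with smaller modulus is not on the circle, where
      \<open>f\<close> is unimodular. It would lie in \<open>S\<close> and could be added to
      \<open>U\<close>, against the maximality of components.\<close>
    have fr: "norm (f p) \<ge> \<eta>" if p: "p \<in> frontier U" for p
    proof (rule ccontr)
      assume less: "\<not> norm (f p) \<ge> \<eta>"
      have "p \<in> cball 0 1" using p Ucb by (auto simp: frontier_def)
      then have "p \<in> S" using less unimod[of p] \<eta> by (force simp: S_def)
      moreover have "p \<notin> U" using p open_U by (simp add: frontier_def interior_open)
      moreover have "p \<in> closure U" using p by (auto simp: frontier_def)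
      moreover have "connected (insert p U)"
        using \<open>p \<in> closure U\<close> U in_components_connected
        by (intro connected_intermediate_closure[of U "insert p U"]) (use closure_subset[of U] in auto)
      ultimately show False
        using components_maximal[OF U, of "insert p U"] US in_components_nonempty[OF U] by auto
    qed
    have nz: "f p \<noteq> 0" if "p \<in> closure U" for p
    proof (cases "p \<in> U")
      case True
      then show ?thesis using UC US zeros by (auto simp: S_def)
    next
      case False
      then have "p \<in> frontier U" using that open_U by (simp add: frontier_def interior_open)
      then show ?thesis using fr \<eta> by fastforce
    qed
    obtain x where x: "x \<in> U" using in_components_nonempty[OF U] by blast
    have "norm (1 / f x) \<le> 1 / \<eta>"
    proof (rule maximum_modulus_frontier[of "\<lambda>z. 1 / f z" U])
      show "(\<lambda>z. 1 / f z) holomorphic_on interior U"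
        using nz closure_subset[of U] US open_U
        by (intro holomorphic_intros holomorphic_on_subset[OF hol])
           (auto simp: interior_open S_def)
      show "continuous_on (closure U) (\<lambda>z. 1 / f z)"
        using nz Ucb by (intro continuous_intros continuous_on_subset[OF cont]) auto
      show "bounded U" using US by (intro bounded_subset[OF bounded_ball[of 0 1]]) (auto simp: S_def)
      show "norm (1 / f z) \<le> 1 / \<eta>" if "z \<in> frontier U" for z
        using fr[OF that] \<eta> by (simp add: norm_divide frac_le)
    qed (rule x)
    moreover have "norm (f x) < \<eta>" "f x \<noteq> 0"
      using x US nz closure_subset by (auto simp: S_def)
    ultimately show False using \<eta> by (simp add: norm_divide field_simps)
  qed
  \<comment> \<open>The connected set \<open>C\<close> lies in every component that it meets, and it
    meets all of them; so there is at most one.\<close>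
  have "U = V" if "U \<in> components S" "V \<in> components S" for U V
  proof -
    have "C \<subseteq> U" "C \<subseteq> V"
      using components_maximal[of _ S C] zero that C by (fastforce simp: S_def)+
    then show ?thesis using components_nonoverlap[OF that] zero that by blast
  qed
  then have "connected S"
    by (metis connected_iff_connected_component_eq componentsI connected_connected_component)
  then show ?thesis by (simp add: S_def)
qed

text \<open>The level set criterion for a single factor, with its only zero as \<open>C\<close>; no
  Euclidean description of the disc is needed.\<close>

lemma connected_pseudo_hyperbolic_disc:
  assumes a: "a \<noteq> 0" "norm a < 1" and \<eta>: "0 < \<eta>" "\<eta> < 1"
  shows "connected {z \<in> unit_disk. norm (blaschke_term a z) < \<eta>}"
proof (rule connected_level_set[where C = "{a}"])
  show "{a} \<subseteq> {z \<in> unit_disk. norm (blaschke_term a z) < \<eta>}"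
    using assms by (simp add: blaschke_term_def)
  show "{z \<in> unit_disk. blaschke_term a z = 0} \<subseteq> {a}"
    using blaschke_term_0_iff[OF a] by auto
qed (use assms in \<open>auto intro: continuous_blaschke_term holomorphic_blaschke_term
       simp: norm_blaschke_term pseudo_hyperbolic_eq_1\<close>)

lemma connected_chain:
  fixes V :: "nat \<Rightarrow> 'a :: topological_space set"
  assumes "\<And>k. connected (V k)" "\<And>k. V k \<inter> V (Suc k) \<noteq> {}"
  shows "connected (\<Union>k\<le>N. V k)"
proof (induction N)
  case (Suc N)
  then show ?case
    using assms(1)[of "Suc N"] assms(2)[of N]
    by (simp add: atMost_Suc) (subst Un_commute, intro connected_Un, auto)
qed (use assms in simp)

text \<open>\<open>\<iota>\<close> orders the zeros along the chain of overlapping discs; this order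
  may differ from that of the indices in the infinite product.\<close>

lemma connected_blaschke_level_set:
  assumes I: "blaschke_zeros I a" and \<iota>: "bij_betw \<iota> UNIV I"
    and \<eta>: "0 < \<eta>" "\<eta> < 1"
    and \<rho>: "\<And>k. pseudo_hyperbolic_dist (a (\<iota> k)) (a (\<iota> (Suc k))) < \<eta>"
  shows "connected {z \<in> unit_disk. norm (blaschke_prod I a z) < \<eta>}"
proof -
  have inI: "\<iota> k \<in> I" for k using \<iota> by (auto simp: bij_betw_def)
  have inj: "inj \<iota>" using \<iota> by (simp add: bij_betw_def)
  note a = blaschke_zerosD[OF I inI]
  define b where "b N z = (\<Prod>k\<le>N. blaschke_term (a (\<iota> k)) z)" for N :: nat and z
  define L where "L N = {z \<in> unit_disk. norm (b N z) < \<eta>}" for N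
  define V where "V k = {z \<in> unit_disk. norm (blaschke_term (a (\<iota> k)) z) < \<eta>}" for k
  have term_le: "norm (blaschke_term (a (\<iota> k)) z) \<le> 1" if "norm z \<le> 1" for k z
    using a[of k] that by (simp add: norm_blaschke_term pseudo_hyperbolic_le_1)
  have conn_L: "connected (L N)" for N
    unfolding L_def
  proof (rule connected_level_set[where C = "\<Union>k\<le>N. V k"])
    show "continuous_on (cball 0 1) (b N)"
      unfolding b_def using a by (intro continuous_intros continuous_blaschke_term) auto
    show "b N holomorphic_on unit_disk"
      unfolding b_def using a by (intro holomorphic_intros holomorphic_blaschke_term) auto
    show "norm (b N z) = 1" if "norm z = 1" for z
      unfolding b_def prod_norm[symmetric] using a that
      by (intro prod.neutral) (auto simp: norm_blaschke_term pseudo_hyperbolic_eq_1)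
    \<comment> \<open>The centre of the next disc lies in both discs.\<close>
    have "V k \<inter> V (Suc k) \<noteq> {}" for k
    proof -
      have "a (\<iota> (Suc k)) \<in> V k \<inter> V (Suc k)"
        using a[of k] a[of "Suc k"] \<rho>[of k] \<eta>
        by (auto simp: V_def norm_blaschke_term) (simp add: pseudo_hyperbolic_dist_def)
      then show ?thesis by blast
    qed
    moreover have "connected (V k)" for k
      unfolding V_def using a \<eta> by (intro connected_pseudo_hyperbolic_disc)
    ultimately show "connected (\<Union>k\<le>N. V k)" by (intro connected_chain)
    show "(\<Union>k\<le>N. V k) \<subseteq> {z \<in> unit_disk. norm (b N z) < \<eta>}"
    proof clarsimp
      fix z k assume k: "k \<le> N" "z \<in> V k"
      then have z: "norm z < 1" "norm (blaschke_term (a (\<iota> k)) z) < \<eta>" by (auto simp: V_def)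
      have "norm (b N z) = norm (blaschke_term (a (\<iota> k)) z) *
          (\<Prod>j\<in>{..N} - {k}. norm (blaschke_term (a (\<iota> j)) z))"
        unfolding b_def prod_norm[symmetric] using k by (subst prod.remove[of _ k]) auto
      also have "\<dots> \<le> norm (blaschke_term (a (\<iota> k)) z)"
        using z term_le by (intro mult_left_le prod_le_1) auto
      finally show "norm z < 1 \<and> norm (b N z) < \<eta>" using z by simp
    qed
    show "{z \<in> unit_disk. b N z = 0} \<subseteq> (\<Union>k\<le>N. V k)"
      using \<eta> by (auto simp: b_def V_def)
  qed (use \<eta> in auto)
  have b_eq: "b N z = blaschke_prod (\<iota> ` {..N}) a z" for N z
    unfolding b_def by (subst blaschke_prod_finite) (auto simp: prod.reindex inj_on_subset[OF inj])
  have "{z \<in> unit_disk. norm (blaschke_prod I a z) < \<eta>} = (\<Union>N. L N)"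
  proof (intro equalityI subsetI)
    fix z assume "z \<in> (\<Union>N. L N)"
    then obtain N where "z \<in> unit_disk" "norm (b N z) < \<eta>" by (auto simp: L_def)
    then show "z \<in> {z \<in> unit_disk. norm (blaschke_prod I a z) < \<eta>}"
      using norm_blaschke_prod_antimono[OF I, of z "\<iota> ` {..N}"] inI by (force simp: b_eq)
  next
    fix z assume "z \<in> {z \<in> unit_disk. norm (blaschke_prod I a z) < \<eta>}"
    then have z: "z \<in> unit_disk" "norm (blaschke_prod I a z) < \<eta>" by auto
    have "\<forall>\<^sub>F N in sequentially. norm (\<Prod>n<N. if n \<in> I then blaschke_term (a n) z else 1) < \<eta>"
      using tendsto_norm[OF blaschke_prod_LIMSEQ[OF I z(1)]] z(2) order_tendstoD(2) by blast
    then obtain N where "norm (\<Prod>n<N. if n \<in> I then blaschke_term (a n) z else 1) < \<eta>"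
      by (auto simp: eventually_sequentially)
    moreover have "(\<Prod>n<N. if n \<in> I then blaschke_term (a n) z else 1) =
        blaschke_prod (I \<inter> {..<N}) a z"
      by (subst blaschke_prod_finite) (simp_all add: prod.inter_restrict Int_commute[of I])
    ultimately have N: "norm (blaschke_prod (I \<inter> {..<N}) a z) < \<eta>" by simp
    \<comment> \<open>Passage from the natural order of \<open>I\<close> to the order of
      \<open>\<iota>\<close>: every index of \<open>I\<close> below \<open>N\<close> is reached by
      step \<open>M\<close>, and the extra factors of \<open>b M\<close> only lower the
      modulus.\<close>
    have "finite (\<iota> -` {..<N})" using inj by (intro finite_vimageI) auto
    then obtain M where M: "\<iota> -` {..<N} \<subseteq> {..M}"
      using finite_nat_iff_bounded_le by blast
    have "I \<inter> {..<N} \<subseteq> \<iota> ` {..M}"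
      using M \<iota> by (fastforce simp: bij_betw_def)
    moreover have "blaschke_zeros (\<iota> ` {..M}) a"
      using inI by (intro blaschke_zeros_subset[OF I]) auto
    ultimately have "norm (b M z) \<le> norm (blaschke_prod (I \<inter> {..<N}) a z)"
      unfolding b_eq using z by (intro norm_blaschke_prod_antimono) auto
    with N z show "z \<in> (\<Union>N. L N)" by (auto simp: L_def intro: le_less_trans)
  qed
  \<comment> \<open>All the sets \<open>L N\<close> share the zero
    \<open>a (\<iota> 0)\<close>.\<close>
  moreover have "connected (\<Union>N. L N)"
  proof (rule connected_Union)
    show "connected S" if "S \<in> range L" for S using that conn_L by auto
    have "b N (a (\<iota> 0)) = 0" for N
      unfolding b_def by (intro prod_zero bexI[of _ 0]) (auto simp: blaschke_term_def)
    then have "a (\<iota> 0) \<in> L N" for N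
      using a[of 0] \<eta> by (simp add: L_def)
    then show "\<Inter> (range L) \<noteq> {}" by blast
  qed
  ultimately show ?thesis by simp
qed

subsection \<open>Interpolation at lacunary sequences\<close>

text \<open>Off the diagonal the rows have absolute sum at most 1/2, so on bounded sequences the
  matrix is the identity plus an operator \<open>E\<close> of norm at most 1/2. Neumann iteration
  inverts it.\<close>

lemma solve_near_identity_system:
  fixes A :: "nat \<Rightarrow> nat \<Rightarrow> complex"
  assumes diag: "\<And>j. A j j = 1"
    and off: "\<And>j N. (\<Sum>k\<in>{..<N} - {j}. norm (A j k)) \<le> 1/2"
    and w: "bounded (range w)"
  obtains c where "bounded (range c)" "\<And>j. (\<lambda>k. c k * A j k) sums w j"
proof -
  define E where "E j k = (if k = j then 0 else A j k)" for j k
  have "(\<Sum>k<N. norm (E j k)) = (\<Sum>k\<in>{..<N} - {j}. norm (A j k))" for j N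
    by (rule sum.mono_neutral_cong_right) (auto simp: E_def)
  then have partial: "(\<Sum>k<N. norm (E j k)) \<le> 1/2" for j N using off by simp
  have sE: "summable (\<lambda>k. norm (E j k))" for j
    by (rule summableI_nonneg_bounded[of _ "1/2"]) (use partial in auto)
  have iE: "(\<Sum>k. norm (E j k)) \<le> 1/2" for j
    using partial by (intro suminf_le_const sE) auto
  have bound: "summable (\<lambda>k. norm (x k * E j k))" "norm (\<Sum>k. x k * E j k) \<le> M / 2"
    if x: "\<And>k. norm (x k) \<le> M" for x :: "nat \<Rightarrow> complex" and M j
  proof -
    have M: "M \<ge> 0" using x[of 0] norm_ge_zero order_trans by blast
    have le: "norm (x k * E j k) \<le> M * norm (E j k)" for k
      unfolding norm_mult by (intro mult_right_mono x) auto
    show s: "summable (\<lambda>k. norm (x k * E j k))"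
      by (rule summable_comparison_test'[OF summable_mult[OF sE[of j], of M]]) (use le in auto)
    have "norm (\<Sum>k. x k * E j k) \<le> (\<Sum>k. norm (x k * E j k))" by (rule summable_norm[OF s])
    also have "\<dots> \<le> (\<Sum>k. M * norm (E j k))"
      by (intro suminf_le s summable_mult sE le)
    also have "\<dots> = M * (\<Sum>k. norm (E j k))" by (rule suminf_mult[OF sE])
    also have "\<dots> \<le> M * (1/2)" by (intro mult_left_mono iE M)
    finally show "norm (\<Sum>k. x k * E j k) \<le> M / 2" by simp
  qed
  obtain W where W: "\<And>j. norm (w j) \<le> W" using w by (auto simp: bounded_iff)
  have diff: "(\<Sum>k. x k * E j k) - (\<Sum>k. y k * E j k) = (\<Sum>k. (x k - y k) * E j k)"
    if x: "\<And>k. norm (x k) \<le> M" and y: "\<And>k. norm (y k) \<le> M" for x y :: "nat \<Rightarrow> complex" and M j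
  proof -
    have "summable (\<lambda>k. x k * E j k)" "summable (\<lambda>k. y k * E j k)"
      using summable_norm_cancel[OF bound(1)[of x M, OF x]] summable_norm_cancel[OF bound(1)[of y M, OF y]]
      by this+
    then show ?thesis by (simp add: suminf_diff algebra_simps)
  qed
  \<comment> \<open>The iterates of \<open>x \<mapsto> w - E x\<close> starting at 0, that is, the
    partial sums of the Neumann series.\<close>
  define c :: "nat \<Rightarrow> nat \<Rightarrow> complex"
    where "c = rec_nat (\<lambda>j. 0) (\<lambda>_ x j. w j - (\<Sum>k. x k * E j k))"
  have c_simps: "c 0 j = 0" "c (Suc n) j = w j - (\<Sum>k. c n k * E j k)" for n j
    by (simp_all add: c_def)
  \<comment> \<open>The bound reproduces itself: \<open>W + 2 * W / 2 = 2 * W\<close>.\<close>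
  have c_le: "norm (c n j) \<le> 2 * W" for n j
  proof (induction n arbitrary: j)
    case 0
    then show ?case using order_trans[OF norm_ge_zero W] by (simp add: c_simps)
  next
    case (Suc n)
    have "norm (\<Sum>k. c n k * E j k) \<le> 2 * W / 2" by (rule bound(2)[OF Suc])
    then show ?case
      using norm_triangle_ineq4[of "w j" "\<Sum>k. c n k * E j k"] W[of j] by (simp add: c_simps)
  qed
  have step: "norm (c (Suc n) j - c n j) \<le> W * (1/2) ^ n" for n j
  proof (induction n arbitrary: j)
    case 0
    then show ?case using W by (simp add: c_simps)
  next
    case (Suc n)
    have "c (Suc (Suc n)) j - c (Suc n) j = - ((\<Sum>k. c (Suc n) k * E j k) - (\<Sum>k. c n k * E j k))"
      unfolding c_simps(2)[of "Suc n"] c_simps(2)[of n j] by simp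
    also have "\<dots> = - (\<Sum>k. (c (Suc n) k - c n k) * E j k)"
      by (subst diff[OF c_le c_le]) (rule refl)
    also have "norm \<dots> \<le> W * (1/2) ^ n / 2"
      unfolding norm_minus_cancel by (rule bound(2)[OF Suc])
    finally show ?case by simp
  qed
  \<comment> \<open>The coordinatewise limit of the iterates, as a telescoping series.\<close>
  define C where "C j = (\<Sum>n. c (Suc n) j - c n j)" for j
  have tail: "norm (C j - c n j) \<le> 2 * W * (1/2) ^ n" for n j
  proof -
    have geo: "(\<lambda>i. W * (1/2) ^ (i + n)) sums (W * (1/2) ^ n * 2)"
      using sums_mult[OF geometric_sums[of "1/2 :: real"], of "W * (1/2) ^ n"]
      by (simp add: power_add mult_ac)
    have s: "summable (\<lambda>n. c (Suc n) j - c n j)"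
      by (rule summable_comparison_test'[of "\<lambda>n. W * (1/2) ^ n"]) (use step in \<open>auto intro: summable_mult\<close>)
    have "C j - c n j = (\<Sum>i. c (Suc (i + n)) j - c (i + n) j)"
      unfolding C_def
      by (subst suminf_minus_initial_segment[OF s]) (simp add: sum_lessThan_telescope[of "\<lambda>n. c n j" n] c_simps(1))
    also have "norm \<dots> \<le> (\<Sum>i. W * (1/2) ^ (i + n))"
      by (rule norm_suminf_le) (use step geo in \<open>auto simp: sums_iff\<close>)
    also have "\<dots> = 2 * W * (1/2) ^ n" using geo by (simp add: sums_iff)
    finally show ?thesis .
  qed
  have C_le: "norm (C j) \<le> 2 * W" for j using tail[of j 0] by (simp add: c_simps)
  \<comment> \<open>Comparison with the \<open>n\<close>-th iterate bounds the defect of the fixed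
    point equation by a null sequence, uniformly in \<open>j\<close>.\<close>
  have C: "C j = w j - (\<Sum>k. C k * E j k)" for j
  proof -
    have "norm (C j - (w j - (\<Sum>k. C k * E j k))) \<le> 2 * W * (1/2) ^ n" for n
    proof -
      have "C j - (w j - (\<Sum>k. C k * E j k)) =
          (C j - c (Suc n) j) + ((\<Sum>k. C k * E j k) - (\<Sum>k. c n k * E j k))"
        by (simp add: c_simps)
      also have "\<dots> = (C j - c (Suc n) j) + (\<Sum>k. (C k - c n k) * E j k)"
        by (subst diff[OF C_le c_le]) (rule refl)
      also have "norm \<dots> \<le> 2 * W * (1/2) ^ Suc n + 2 * W * (1/2) ^ n / 2"
        by (intro norm_triangle_mono tail bound(2))
      finally show ?thesis by simp
    qed
    moreover have "(\<lambda>n. 2 * W * (1/2) ^ n) \<longlonglongrightarrow> 0"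
      by (intro tendsto_mult_right_zero LIMSEQ_power_zero) simp
    ultimately have "norm (C j - (w j - (\<Sum>k. C k * E j k))) \<le> 0"
      by (intro LIMSEQ_le_const) auto
    then show ?thesis by simp
  qed
  have "(\<lambda>k. C k * A j k) sums w j" for j
  proof -
    have "(\<lambda>k. C k * E j k) sums (\<Sum>k. C k * E j k)"
      using summable_norm_cancel[OF bound(1)[of C, OF C_le]] by (rule summable_sums)
    moreover have "(\<lambda>k. if k = j then C k else 0) sums C j"
      by (rule sums_single)
    ultimately have "(\<lambda>k. C k * E j k + (if k = j then C k else 0)) sums ((\<Sum>k. C k * E j k) + C j)"
      by (rule sums_add)
    moreover have "C k * E j k + (if k = j then C k else 0) = C k * A j k" for k
      using diag by (simp add: E_def)
    ultimately show ?thesis using C[of j] by simp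
  qed
  moreover have "bounded (range C)" using C_le by (auto simp: bounded_iff)
  ultimately show ?thesis using that by blast
qed

text \<open>Here 1/16 is the sum of \<open>17 ^ (-i)\<close> over \<open>i \<ge> 1\<close>. The
  induction closes because \<open>1/16 + 1 = 17/16\<close> and one step gains the factor 17.\<close>

lemma lacunary_sum_inverse:
  fixes d :: "nat \<Rightarrow> real"
  assumes "\<And>k. 0 < d k" "\<And>k. 17 * d (Suc k) \<le> d k"
  shows "(\<Sum>k<m. 1 / d k) \<le> 1 / (16 * d m)"
proof (induction m)
  case (Suc m)
  have "(\<Sum>k<Suc m. 1 / d k) \<le> 1 / (16 * d m) + 1 / d m" using Suc by simp
  also have "\<dots> = 17 / (16 * d m)" using assms(1)[of m] by (simp add: field_simps)
  also have "\<dots> \<le> 17 / (16 * (17 * d (Suc m)))"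
    using assms(1)[of m] assms(1)[of "Suc m"] assms(2)[of m] by (intro divide_left_mono) auto
  finally show ?case by simp
qed (use assms(1)[of 0] in simp)

lemma lacunary_sum:
  fixes d :: "nat \<Rightarrow> real"
  assumes "\<And>k. 0 < d k" "\<And>k. 17 * d (Suc k) \<le> d k"
  shows "(\<Sum>k=m..<N. d k) \<le> 17/16 * d m"
proof -
  \<comment> \<open>The subtracted term \<open>d (m + i)\<close> strengthens the claim enough for
    the induction; the constant is the geometric sum \<open>17/16\<close>.\<close>
  have "(\<Sum>k<i. d (m + k)) \<le> 17/16 * (d m - d (m + i))" for i
  proof (induction i)
    case (Suc i)
    then show ?case using assms(2)[of "m + i"] by (simp add: field_simps)
  qed simp
  from this[of "N - m"] have "(\<Sum>k<N-m. d (m + k)) \<le> 17/16 * d m"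
    using assms(1)[of "m + (N - m)"] by simp
  moreover have "(\<Sum>k=m..<N. d k) = (\<Sum>k<N-m. d (m + k))"
    using sum.shift_bounds_nat_ivl[of d 0 m "N - m"]
    by (cases "m \<le> N") (auto simp: add.commute lessThan_atLeast0)
  ultimately show ?thesis by simp
qed

text \<open>The ratio 17 is chosen so that at each node the peaks with smaller index and those with
  larger index contribute at most 1/4 each, which is the 1/2 that the near-identity system
  allows.\<close>

lemma lacunary_interpolation:
  fixes z :: "nat \<Rightarrow> complex"
  assumes \<xi>: "norm \<xi> = 1" and z: "range z \<subseteq> unit_disk"
    and lac: "\<And>k. 17 * norm (\<xi> - z (Suc k)) \<le> norm (\<xi> - z k)"
    and w: "bounded (range w)"
  shows "\<exists>f\<in>H_infinity. \<forall>n. f (z n) = w n"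
proof -
  define d where "d k = norm (\<xi> - z k)" for k
  have neq: "v \<noteq> \<xi>" if "v \<in> unit_disk" for v using that \<xi> by auto
  have d: "0 < d k" for k using neq[of "z k"] z by (force simp: d_def)
  have lacd: "17 * d (Suc k) \<le> d k" for k using lac by (simp add: d_def)
  \<comment> \<open>\<open>u\<close> maps the disk into the right half-plane and preserves the
    distance to \<xi>, so \<open>u v + d k\<close> cannot vanish.\<close>
  define u where "u v = 1 - cnj \<xi> * v" for v
  have nu: "norm (u v) = norm (\<xi> - v)" for v
  proof -
    have "u v = cnj \<xi> * (\<xi> - v)"
      using complex_norm_square[of \<xi>] \<xi> by (simp add: u_def algebra_simps)
    then show ?thesis using \<xi> by (simp add: norm_mult)
  qed
  have Re_u: "Re (u v) > 0" if "v \<in> unit_disk" for v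
  proof -
    have "norm (cnj \<xi> * v) < 1" using that \<xi> by (simp add: norm_mult)
    then have "Re (cnj \<xi> * v) < 1" using complex_Re_le_cmod le_less_trans by blast
    then show ?thesis by (simp add: u_def)
  qed
  define h where "h k v = 4 * of_real (d k) * u v / (u v + of_real (d k))\<^sup>2" for k v
  have nz: "u v + of_real (d k) \<noteq> 0" if "v \<in> unit_disk" for k v
    using Re_u[OF that] d[of k] by (auto simp: complex_eq_iff)
  \<comment> \<open>As \<open>Re (u v) > 0\<close>, the denominator dominates both
    \<open>(d k)\<^sup>2\<close> and \<open>(norm (u v))\<^sup>2\<close>. So \<open>h k\<close>
    peaks at distance about \<open>d k\<close> from \<xi> and decays linearly in the ratio of the
    distances on either side.\<close>
  have h_le: "norm (h k v) \<le> 4 * norm (\<xi> - v) / d k" "norm (h k v) \<le> 4 * d k / norm (\<xi> - v)"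
    if v: "v \<in> unit_disk" for k v
  proof -
    have x: "0 < norm (u v)" using Re_u[OF v] by auto
    have sq: "(norm (u v + of_real (d k)))\<^sup>2 = (norm (u v))\<^sup>2 + 2 * d k * Re (u v) + (d k)\<^sup>2"
      unfolding cmod_power2 by (simp add: power2_eq_square algebra_simps)
    then have ge: "(d k)\<^sup>2 \<le> (norm (u v + of_real (d k)))\<^sup>2" "(norm (u v))\<^sup>2 \<le> (norm (u v + of_real (d k)))\<^sup>2"
      using d[of k] Re_u[OF v] by auto
    have pos: "0 < (norm (u v + of_real (d k)))\<^sup>2" using nz[OF v, of k] by simp
    have nh: "norm (h k v) = 4 * d k * norm (u v) / (norm (u v + of_real (d k)))\<^sup>2"
      using d[of k] by (simp add: h_def norm_mult norm_divide norm_power)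
    have "norm (h k v) \<le> 4 * d k * norm (u v) / (d k)\<^sup>2"
      unfolding nh using d[of k] ge pos by (intro divide_left_mono) auto
    then show "norm (h k v) \<le> 4 * norm (\<xi> - v) / d k"
      using d[of k] by (simp add: nu power2_eq_square)
    have "norm (h k v) \<le> 4 * d k * norm (u v) / (norm (u v))\<^sup>2"
      unfolding nh using d[of k] ge pos x by (intro divide_left_mono) auto
    then show "norm (h k v) \<le> 4 * d k / norm (\<xi> - v)"
      using x by (simp add: nu power2_eq_square)
  qed
  \<comment> \<open>The factor 4 in \<open>h\<close> serves this bound: normalising at the node then
    never enlarges the function.\<close>
  have h_ge: "norm (h k (z k)) \<ge> 1" for k
  proof -
    have zk: "z k \<in> unit_disk" using z by blast
    have "norm (u (z k) + of_real (d k)) \<le> 2 * d k"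
      using norm_triangle_ineq[of "u (z k)" "of_real (d k)"] d[of k] by (simp add: nu d_def)
    then have "(norm (u (z k) + of_real (d k)))\<^sup>2 \<le> (2 * d k)\<^sup>2" by (intro power_mono) auto
    moreover have "norm (h k (z k)) = 4 * d k * d k / (norm (u (z k) + of_real (d k)))\<^sup>2"
      using d[of k] by (simp add: h_def norm_mult norm_divide norm_power nu flip: d_def)
    ultimately show ?thesis using nz[OF zk, of k] d[of k]
      by (simp add: power2_eq_square)
  qed
  define g where "g k v = h k v / h k (z k)" for k v
  have g_le_h: "norm (g k v) \<le> norm (h k v)" for k v
    using h_ge[of k] by (simp add: g_def norm_divide divide_le_eq mult_le_cancel_left1 not_less mult_left_le)
  have low: "(\<Sum>k<m. norm (g k v)) \<le> norm (\<xi> - v) / (4 * d m)" if v: "v \<in> unit_disk" for m v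
  proof -
    have "(\<Sum>k<m. norm (g k v)) \<le> (\<Sum>k<m. 4 * norm (\<xi> - v) * (1 / d k))"
      using order_trans[OF g_le_h h_le(1)[OF v]] by (intro sum_mono) simp
    also have "\<dots> = 4 * norm (\<xi> - v) * (\<Sum>k<m. 1 / d k)" by (simp add: sum_distrib_left)
    also have "\<dots> \<le> 4 * norm (\<xi> - v) * (1 / (16 * d m))"
      by (intro mult_left_mono lacunary_sum_inverse d lacd) auto
    finally show ?thesis by simp
  qed
  have high: "(\<Sum>k=m..<N. norm (g k v)) \<le> 17/4 * (d m / norm (\<xi> - v))" if v: "v \<in> unit_disk" for m N v
  proof -
    have "(\<Sum>k=m..<N. norm (g k v)) \<le> (\<Sum>k=m..<N. 4 / norm (\<xi> - v) * d k)"
      using order_trans[OF g_le_h h_le(2)[OF v]] by (intro sum_mono) simp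
    also have "\<dots> = 4 / norm (\<xi> - v) * (\<Sum>k=m..<N. d k)" by (simp add: sum_distrib_left)
    also have "\<dots> \<le> 4 / norm (\<xi> - v) * (17/16 * d m)"
      by (intro mult_left_mono lacunary_sum d lacd) auto
    finally show ?thesis by simp
  qed
  have d_lim: "\<exists>m. d m \<le> x" if "x > 0" for x
  proof -
    have "d m * 17 ^ m \<le> d 0" for m
    proof (induction m)
      case (Suc m)
      have "d (Suc m) * 17 ^ Suc m \<le> d m * 17 ^ m" using lacd[of m] by simp
      with Suc show ?case by linarith
    qed simp
    moreover obtain m where "d 0 / x < 17 ^ m" using real_arch_pow[of 17 "d 0 / x"] by auto
    ultimately have "d m * 17 ^ m < x * 17 ^ m"
      using that by (smt (verit) divide_less_eq mult.commute)
    then show ?thesis by (intro exI[of _ m]) simp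
  qed
  have total: "(\<Sum>k<N. norm (g k v)) \<le> 9" if v: "v \<in> unit_disk" for v N
  proof -
    define x where "x = norm (\<xi> - v)"
    have x: "x > 0" using neq[OF v] by (simp add: x_def)
    \<comment> \<open>The first scale not exceeding \<open>x\<close>: from \<open>m\<close> on the
      second decay bound sums well, below \<open>m\<close> the first one.\<close>
    define m where "m = (LEAST m. d m \<le> x)"
    have m: "d m \<le> x" using LeastI_ex[OF d_lim[OF x]] by (simp add: m_def)
    have hi: "(\<Sum>k=m..<N. norm (g k v)) \<le> 17/4"
    proof -
      have "d m / x \<le> 1" using m x by simp
      then show ?thesis using high[OF v, of m N] by (simp add: x_def[symmetric])
    qed
    \<comment> \<open>The term \<open>i = m - 1\<close> is split off with its bound 4, since
      \<open>x / d m\<close> has no upper bound but \<open>x / d i\<close> is at most 1; in total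
      \<open>1/4 + 4 = 17/4\<close>.\<close>
    have lo: "(\<Sum>k<m. norm (g k v)) \<le> 17/4"
    proof (cases m)
      case (Suc i)
      then have i: "x < d i" using not_less_Least[of i "\<lambda>m. d m \<le> x"] by (auto simp: m_def)
      have "(\<Sum>k<i. norm (g k v)) \<le> 1/4"
      proof -
        have "x / d i \<le> 1" using i d[of i] by simp
        then show ?thesis using low[OF v, of i] by (simp add: x_def[symmetric])
      qed
      moreover have "norm (g i v) \<le> 4"
      proof -
        have "x / d i \<le> 1" using i d[of i] by simp
        then show ?thesis using order_trans[OF g_le_h h_le(1)[OF v], of i] by (simp add: x_def[symmetric])
      qed
      ultimately show ?thesis using Suc by simp
    qed simp
    have "(\<Sum>k<N. norm (g k v)) \<le> (\<Sum>k\<in>{..<m} \<union> {m..<N}. norm (g k v))"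
      by (intro sum_mono2) auto
    also have "\<dots> = (\<Sum>k<m. norm (g k v)) + (\<Sum>k=m..<N. norm (g k v))"
      by (intro sum.union_disjoint) auto
    finally show ?thesis using hi lo by simp
  qed
  have off: "(\<Sum>k\<in>{..<N} - {j}. norm (g k (z j))) \<le> 1/2" for j N
  proof -
    have zj: "z j \<in> unit_disk" using z by blast
    have "(\<Sum>k\<in>{..<N} - {j}. norm (g k (z j))) \<le> (\<Sum>k\<in>{..<j} \<union> {Suc j..<N}. norm (g k (z j)))"
      by (intro sum_mono2) auto
    also have "\<dots> = (\<Sum>k<j. norm (g k (z j))) + (\<Sum>k=Suc j..<N. norm (g k (z j)))"
      by (intro sum.union_disjoint) auto
    also have "\<dots> \<le> 1/4 + 1/4"
    proof (rule add_mono)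
      show "(\<Sum>k<j. norm (g k (z j))) \<le> 1/4"
        using low[OF zj, of j] d[of j] by (simp add: d_def[symmetric])
      show "(\<Sum>k=Suc j..<N. norm (g k (z j))) \<le> 1/4"
      proof -
        have "d (Suc j) / d j \<le> 1/17" using d[of j] lacd[of j] by (simp add: field_simps)
        then show ?thesis using high[OF zj, of "Suc j" N] unfolding d_def[symmetric] by linarith
      qed
    qed
    finally show ?thesis by simp
  qed
  have "g j (z j) = 1" for j using h_ge[of j] by (auto simp: g_def)
  then obtain c where c: "bounded (range c)" "\<And>j. (\<lambda>k. c k * g k (z j)) sums w j"
    using solve_near_identity_system[of "\<lambda>j k. g k (z j)"] off w by metis
  obtain M where M: "\<And>k. norm (c k) \<le> M" using c(1) by (auto simp: bounded_iff)
  have M0: "M \<ge> 0" using M[of 0] norm_ge_zero order_trans by blast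
  define f where "f v = (\<Sum>k. c k * g k v)" for v
  have "summable d"
    by (rule summableI_nonneg_bounded[of _ "17/16 * d 0"])
       (use d lacunary_sum[of d 0, OF d lacd] in \<open>auto simp: less_imp_le lessThan_atLeast0\<close>)
  have "f holomorphic_on unit_disk"
  proof (rule holomorphic_uniform_sequence)
    show "(\<lambda>v. \<Sum>k<N. c k * g k v) holomorphic_on unit_disk" for N
      unfolding g_def h_def using nz unfolding u_def
      by (intro holomorphic_intros) (auto simp: divide_eq_0_iff)
    fix x :: complex assume x: "x \<in> unit_disk"
    define r where "r = (1 - norm x) / 2"
    have r: "r > 0" using x by (simp add: r_def)
    have ge: "r \<le> norm (\<xi> - v) \<and> norm v < 1" if "v \<in> cball x r" for v
    proof -
      have "norm v \<le> norm x + r" using that norm_triangle_sub[of v x] by (simp add: dist_norm norm_minus_commute)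
      then have "norm v \<le> 1 - r" by (simp add: r_def field_simps)
      then show ?thesis using norm_triangle_ineq2[of \<xi> v] \<xi> r by simp
    qed
    have "uniform_limit (cball x r) (\<lambda>N v. \<Sum>k<N. c k * g k v) f sequentially"
      unfolding f_def
    proof (rule Weierstrass_m_test[where M = "\<lambda>k. M * 4 / r * d k"])
      fix k v assume v: "v \<in> cball x r"
      have "norm (g k v) \<le> 4 * d k / norm (\<xi> - v)"
        using order_trans[OF g_le_h h_le(2)] ge[OF v] by simp
      also have "\<dots> \<le> 4 * d k / r"
        using ge[OF v] r d[of k] less_le_trans[OF r, of "norm (\<xi> - v)"] by (intro divide_left_mono mult_pos_pos) auto
      finally have "norm (c k) * norm (g k v) \<le> M * (4 * d k / r)"
        by (intro mult_mono M M0) auto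
      then show "norm (c k * g k v) \<le> M * 4 / r * d k" by (simp add: norm_mult)
    qed (intro summable_mult \<open>summable d\<close>)
    with r ge show "\<exists>r>0. cball x r \<subseteq> unit_disk \<and>
        uniform_limit (cball x r) (\<lambda>N v. \<Sum>k<N. c k * g k v) f sequentially"
      by fastforce
  qed auto
  moreover have "norm (f v) \<le> M * 9" if v: "v \<in> unit_disk" for v
  proof -
    have s: "(\<Sum>k<N. norm (c k * g k v)) \<le> M * 9" for N
    proof -
      have "(\<Sum>k<N. norm (c k * g k v)) \<le> (\<Sum>k<N. M * norm (g k v))"
        unfolding norm_mult by (intro sum_mono mult_right_mono M) auto
      also have "\<dots> = M * (\<Sum>k<N. norm (g k v))" by (simp add: sum_distrib_left)
      also have "\<dots> \<le> M * 9" by (intro mult_left_mono total v M0)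
      finally show ?thesis .
    qed
    have sm: "summable (\<lambda>k. norm (c k * g k v))"
      by (rule summableI_nonneg_bounded[of _ "M * 9"]) (use s in auto)
    show ?thesis
      unfolding f_def by (rule order_trans[OF summable_norm[OF sm] suminf_le_const[OF sm s]])
  qed
  ultimately have "f \<in> H_infinity" unfolding H_infinity_def bounded_iff by blast
  moreover have "f (z j) = w j" for j using c(2)[of j] by (simp add: f_def sums_iff)
  ultimately show ?thesis by blast
qed

subsection \<open>Radial limits and zeros\<close>

text \<open>The finitely many zeros at distance at least \<open>\<epsilon> / 2\<close> from \<xi>
  are handled by \<open>1 - norm (a n)\<close>. For the others, replacing \<open>a n\<close> by
  \<xi> changes \<open>1 - cnj (a n) * z\<close> by at most \<open>\<epsilon> / 2\<close>, while the
  new value has modulus at least \<epsilon>.\<close>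

lemma blaschke_zeros_separated:
  assumes I: "blaschke_zeros I a" and \<xi>: "norm \<xi> = 1" and \<epsilon>: "\<epsilon> > 0"
    and acc: "finite {n\<in>I. \<epsilon> / 2 \<le> norm (\<xi> - a n)}"
  obtains \<kappa> where "\<kappa> > 0"
    "\<And>n z. n \<in> I \<Longrightarrow> z \<in> cball 0 1 - ball \<xi> \<epsilon> \<Longrightarrow> \<kappa> \<le> norm (1 - cnj (a n) * z)"
proof -
  define F where "F = {n\<in>I. \<epsilon> / 2 \<le> norm (\<xi> - a n)}"
  define \<kappa> where "\<kappa> = Min (insert (\<epsilon> / 2) ((\<lambda>n. 1 - norm (a n)) ` F))"
  have F: "finite F" using acc by (simp add: F_def)
  have "\<kappa> > 0"
    using F \<epsilon> blaschke_zerosD(2)[OF I] by (auto simp: \<kappa>_def F_def)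
  moreover have "\<kappa> \<le> norm (1 - cnj (a n) * z)" if n: "n \<in> I" and z: "z \<in> cball 0 1 - ball \<xi> \<epsilon>" for n z
  proof (cases "n \<in> F")
    case True
    then have "\<kappa> \<le> 1 - norm (a n)" using F by (auto simp: \<kappa>_def)
    also have "\<dots> \<le> norm (1 - cnj (a n) * z)" using z by (intro one_minus_mult_ge) auto
    finally show ?thesis .
  next
    case False
    have "1 - cnj (a n) * z = cnj \<xi> * (\<xi> - z) - cnj (a n - \<xi>) * z"
      using complex_norm_square[of \<xi>] \<xi> by (simp add: algebra_simps)
    then have "norm (1 - cnj (a n) * z) \<ge> norm (cnj \<xi> * (\<xi> - z)) - norm (cnj (a n - \<xi>) * z)"
      by (metis norm_triangle_ineq2)
    moreover have "norm (cnj \<xi> * (\<xi> - z)) \<ge> \<epsilon>"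
      using z \<xi> by (auto simp: norm_mult dist_norm)
    moreover have "norm (cnj (a n - \<xi>) * z) \<le> \<epsilon> / 2 * 1"
      unfolding norm_mult complex_mod_cnj
      using False n z \<epsilon> by (intro mult_mono) (auto simp: F_def norm_minus_commute)
    moreover have "\<kappa> \<le> \<epsilon> / 2" unfolding \<kappa>_def using F by (intro Min_le) auto
    ultimately show ?thesis by linarith
  qed
  ultimately show ?thesis using that by blast
qed

text \<open>Away from \<xi> the convergence is uniform up to the circle. So the product is
  continuous at \<zeta>, and its modulus there is the limit of the moduli of unimodular partial
  products.\<close>

lemma blaschke_prod_radial_limit:
  assumes I: "blaschke_zeros I a" and \<xi>: "norm \<xi> = 1"
    and acc: "\<And>\<epsilon>. \<epsilon> > 0 \<Longrightarrow> finite {n\<in>I. \<epsilon> \<le> norm (\<xi> - a n)}"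
    and \<zeta>: "norm \<zeta> = 1" "\<zeta> \<noteq> \<xi>"
  shows "norm (blaschke_prod I a \<zeta>) = 1"
    and "((\<lambda>r. blaschke_prod I a (of_real r * \<zeta>)) \<longlongrightarrow> blaschke_prod I a \<zeta>) (at_left 1)"
proof -
  let ?P = "\<lambda>N z. \<Prod>n<N. if n \<in> I then blaschke_term (a n) z else 1"
  define \<epsilon> where "\<epsilon> = norm (\<xi> - \<zeta>) / 2"
  have \<epsilon>: "\<epsilon> > 0" using \<zeta> by (simp add: \<epsilon>_def)
  define X where "X = cball 0 1 - ball \<xi> \<epsilon>"
  obtain \<kappa> where \<kappa>: "\<kappa> > 0" "\<And>n z. n \<in> I \<Longrightarrow> z \<in> X \<Longrightarrow> \<kappa> \<le> norm (1 - cnj (a n) * z)"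
    using blaschke_zeros_separated[OF I \<xi> \<epsilon> acc] \<epsilon> unfolding X_def by auto
  have X: "X \<subseteq> cball 0 1" "compact X" by (auto simp: X_def intro: compact_diff)
  have lim: "uniform_limit X ?P (blaschke_prod I a) sequentially"
    by (rule uniform_limit_blaschke_prod(1)[OF I X \<kappa>])
  have cont: "continuous_on X (blaschke_prod I a)"
  proof (rule uniform_limit_theorem[OF _ lim])
    have "continuous_on X (\<lambda>z. if n \<in> I then blaschke_term (a n) z else 1)" for n
      using blaschke_zerosD[OF I, of n] X by (cases "n \<in> I") (auto intro: continuous_blaschke_term)
    then show "\<forall>\<^sub>F N in sequentially. continuous_on X (?P N)"
      by (intro always_eventually allI continuous_on_prod)
  qed simp
  have \<zeta>X: "\<zeta> \<in> X" using \<zeta> \<epsilon> by (simp add: X_def dist_norm \<epsilon>_def)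
  have "norm (?P N \<zeta>) = 1" for N
    unfolding prod_norm[symmetric] using \<zeta>(1) blaschke_zerosD[OF I]
    by (intro prod.neutral) (auto simp: norm_blaschke_term pseudo_hyperbolic_eq_1)
  then have "(\<lambda>N. 1) \<longlonglongrightarrow> norm (blaschke_prod I a \<zeta>)"
    using tendsto_norm[OF tendsto_uniform_limitI[OF lim \<zeta>X]] by simp
  then show "norm (blaschke_prod I a \<zeta>) = 1" by (simp add: LIMSEQ_const_iff)
  have "((\<lambda>r. of_real r * \<zeta>) \<longlongrightarrow> of_real 1 * \<zeta>) (at_left 1)"
    by (intro tendsto_intros)
  moreover have "\<forall>\<^sub>F r in at_left 1. of_real r * \<zeta> \<in> X"
  proof -
    have "\<forall>\<^sub>F r in at_left (1::real). r \<in> {max 0 (1 - \<epsilon>)<..<1}"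
      using \<epsilon> by (intro eventually_at_left_real) auto
    then show ?thesis
    proof (rule eventually_mono)
      fix r assume r: "r \<in> {max 0 (1 - \<epsilon>)<..<1}"
      have "\<zeta> - of_real r * \<zeta> = of_real (1 - r) * \<zeta>" by (simp add: algebra_simps)
      then have "norm (\<zeta> - of_real r * \<zeta>) = 1 - r"
        using r \<zeta>(1) by (simp add: norm_mult del: of_real_diff)
      then have "norm (\<xi> - of_real r * \<zeta>) \<ge> \<epsilon>"
        using norm_triangle_ineq[of "\<xi> - of_real r * \<zeta>" "of_real r * \<zeta> - \<zeta>"] r
        by (simp add: \<epsilon>_def norm_minus_commute)
      then show "of_real r * \<zeta> \<in> X"
        using r \<zeta>(1) by (simp add: X_def dist_norm norm_mult)
    qed
  qed
  ultimately show "((\<lambda>r. blaschke_prod I a (of_real r * \<zeta>)) \<longlongrightarrow> blaschke_prod I a \<zeta>) (at_left 1)"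
    using continuous_on_tendsto_compose[OF cont, of "\<lambda>r. of_real r * \<zeta>" \<zeta>] \<zeta>X by simp
qed

lemma countable_cis_eq: "countable {t. cis t = \<xi>}"
proof (cases "\<exists>s. cis s = \<xi>")
  case True
  then obtain s where s: "cis s = \<xi>" by blast
  have "{t. cis t = \<xi>} \<subseteq> range (\<lambda>n::int. s + of_int n * (2 * pi))"
  proof
    fix t assume "t \<in> {t. cis t = \<xi>}"
    then have "sin t = sin s \<and> cos t = cos s" using s by (auto simp: complex_eq_iff)
    then obtain n :: int where "t = s + 2 * pi * of_int n" by (auto simp: sin_cos_eq_iff)
    then show "t \<in> range (\<lambda>n::int. s + of_int n * (2 * pi))" by (auto simp: mult_ac)
  qed
  then show ?thesis by (rule countable_subset) auto
qed auto

text \<open>Radial limits are controlled in every direction but \<xi>, and the angles of that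
  direction form a countable, hence null, set. Serves both the factor and its cofactor, hence the
  general \<open>c\<close> and \<open>m\<close>.\<close>

lemma blaschke_productI:
  assumes I: "blaschke_zeros I a" and \<xi>: "norm \<xi> = 1" and c: "norm c = 1"
    and acc: "\<And>\<epsilon>. \<epsilon> > 0 \<Longrightarrow> finite {n\<in>I. \<epsilon> \<le> norm (\<xi> - a n)}"
    and B: "\<And>z. z \<in> unit_disk \<Longrightarrow> B z = c * z ^ m * blaschke_prod I a z"
  shows "blaschke_product B"
proof -
  have "B holomorphic_on unit_disk \<longleftrightarrow> (\<lambda>z. c * z ^ m * blaschke_prod I a z) holomorphic_on unit_disk"
    using B by (intro holomorphic_cong) auto
  then have "B holomorphic_on unit_disk"
    using holomorphic_blaschke_prod[OF I] by (auto intro!: holomorphic_intros)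
  moreover have "norm (B z) \<le> 1" if "z \<in> unit_disk" for z
    using B[OF that] c that norm_blaschke_prod_le_1[OF I that]
    by (auto simp: norm_mult norm_power intro!: mult_le_one power_le_one)
  ultimately have "B \<in> H_infinity" unfolding H_infinity_def bounded_iff by blast
  have rad: "\<exists>l. norm l = 1 \<and> ((\<lambda>r. B (of_real r * cis t)) \<longlongrightarrow> l) (at_left 1)" if t: "cis t \<noteq> \<xi>" for t
  proof (intro exI conjI)
    note lim = blaschke_prod_radial_limit[OF I \<xi> acc _ t]
    show "norm (c * cis t ^ m * blaschke_prod I a (cis t)) = 1"
      using lim(1) c by (simp add: norm_mult norm_power)
    have "((\<lambda>r. c * (of_real r * cis t) ^ m * blaschke_prod I a (of_real r * cis t)) \<longlongrightarrow>
        c * (of_real 1 * cis t) ^ m * blaschke_prod I a (cis t)) (at_left 1)"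
      using lim(2) by (intro tendsto_intros) auto
    moreover have "\<forall>\<^sub>F r in at_left (1::real). r \<in> {0<..<1}"
      by (intro eventually_at_left_real) auto
    then have "\<forall>\<^sub>F r in at_left (1::real).
        c * (of_real r * cis t) ^ m * blaschke_prod I a (of_real r * cis t) = B (of_real r * cis t)"
      by (rule eventually_mono) (auto simp: B norm_mult)
    ultimately show "((\<lambda>r. B (of_real r * cis t)) \<longlongrightarrow>
        c * cis t ^ m * blaschke_prod I a (cis t)) (at_left 1)"
      by (auto elim: Lim_transform_eventually)
  qed
  have "{t. cis t = \<xi>} \<in> null_sets lebesgue"
    by (intro null_sets_completionI countable_imp_null_set_lborel countable_cis_eq)
  then have "AE t in lebesgue. cis t \<noteq> \<xi>"
    using AE_not_in by fastforce
  then have "AE t in lebesgue. t \<in> {0..2*pi} \<longrightarrow>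
      (\<exists>l. norm l = 1 \<and> ((\<lambda>r. B (of_real r * cis t)) \<longlongrightarrow> l) (at_left 1))"
    by (rule eventually_mono) (use rad in blast)
  then have "AE t in lebesgue_on {0..2*pi}.
      \<exists>l. norm l = 1 \<and> ((\<lambda>r. B (of_real r * cis t)) \<longlongrightarrow> l) (at_left 1)"
    by (subst AE_restrict_space_iff) auto
  then have "inner_function B" using \<open>B \<in> H_infinity\<close> by (simp add: inner_function_def)
  then show ?thesis
    using I c B unfolding blaschke_product_def blaschke_zeros_def blaschke_prod_def by blast
qed

section \<open>Zeros and their multiplicities\<close>

text \<open>Splitting off the factor of index \<open>i\<close> leaves a holomorphic function
  \<open>g\<close> that does not vanish at \<open>a i\<close>, as no other index carries the same
  zero.\<close>

lemma zorder_blaschke_prod: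
  assumes I: "blaschke_zeros I a" and i: "i \<in> I" "a i \<notin> a ` (I - {i})"
  shows "zorder (blaschke_prod I a) (a i) = 1"
proof -
  note ai = blaschke_zerosD[OF I i(1)]
  have I': "blaschke_zeros (I - {i}) a" by (rule blaschke_zeros_subset[OF I]) auto
  define g where "g w = - (of_real (norm (a i)) / a i) / (1 - cnj (a i) * w) * blaschke_prod (I - {i}) a w" for w
  show ?thesis
  proof (rule zorder_eqI)
    show "g holomorphic_on unit_disk"
      unfolding g_def using ai one_minus_mult_nz[of "a i"] holomorphic_blaschke_prod[OF I']
      by (auto intro!: holomorphic_intros)
    show "g (a i) \<noteq> 0"
      using ai one_minus_mult_nz[of "a i" "a i"] blaschke_prod_nonzero[OF I', of "a i"] i
      by (auto simp: g_def)
    fix w assume w: "w \<in> unit_disk"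
    have "I = {i} \<union> (I - {i})" using i by auto
    then have "blaschke_prod I a w = blaschke_term (a i) w * blaschke_prod (I - {i}) a w"
      using blaschke_prod_Un[of "{i}" "I - {i}" a w] I w by (simp add: blaschke_prod_finite)
    also have "blaschke_term (a i) w = - (of_real (norm (a i)) / a i) / (1 - cnj (a i) * w) * (w - a i)"
      by (simp add: blaschke_term_def divide_simps)  (simp add: algebra_simps)
    finally show "blaschke_prod I a w = g w * (w - a i) powi 1" by (simp add: g_def)
  qed (use ai in auto)
qed

lemma zero_sequence_blaschke_prod:
  assumes I: "blaschke_zeros I a" and \<iota>: "bij_betw \<iota> UNIV I" and inj: "inj (\<lambda>k. a (\<iota> k))"
  shows "zero_sequence (blaschke_prod I a) (\<lambda>k. a (\<iota> k))"
proof -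
  have inI: "\<iota> k \<in> I" for k using \<iota> by (auto simp: bij_betw_def)
  have img: "I = range \<iota>" using \<iota> by (simp add: bij_betw_def)
  have "finite {k. a (\<iota> k) = \<alpha>} \<and> int (card {k. a (\<iota> k) = \<alpha>}) = zorder (blaschke_prod I a) \<alpha>"
    if \<alpha>: "\<alpha> \<in> unit_disk" for \<alpha>
  proof (cases "\<alpha> \<in> a ` I")
    case True
    then obtain k where k: "\<alpha> = a (\<iota> k)" using img by auto
    have "{j. a (\<iota> j) = \<alpha>} = {k}" using k injD[OF inj] by auto
    moreover have "a (\<iota> k) \<notin> a ` (I - {\<iota> k})" using injD[OF inj] img by force
    then have "zorder (blaschke_prod I a) \<alpha> = 1"
      unfolding k by (intro zorder_blaschke_prod[OF I inI])
    ultimately show ?thesis by simp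
  next
    case False
    then have "{j. a (\<iota> j) = \<alpha>} = {}" using inI by auto
    moreover have "zorder (blaschke_prod I a) \<alpha> = 0"
      using blaschke_prod_nonzero[OF I \<alpha> False] \<alpha> holomorphic_blaschke_prod[OF I]
      by (intro zorder_eq_0I holomorphic_on_imp_analytic_at) auto
    ultimately show ?thesis by simp
  qed
  moreover have "a (\<iota> k) \<in> unit_disk" for k using blaschke_zerosD(2)[OF I inI] by simp
  ultimately show ?thesis unfolding zero_sequence_def by blast
qed

text \<open>The point \<beta> rules out the zero function, so that \<open>zorder\<close> is positive
  exactly at the zeros.\<close>

lemma mem_zero_sequence_iff:
  assumes z: "zero_sequence B z" and B: "B holomorphic_on unit_disk"
    and \<beta>: "\<beta> \<in> unit_disk" "B \<beta> \<noteq> 0" and \<alpha>: "\<alpha> \<in> unit_disk"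
  shows "\<alpha> \<in> range z \<longleftrightarrow> B \<alpha> = 0"
proof -
  have card: "finite {n. z n = \<alpha>}" "int (card {n. z n = \<alpha>}) = zorder B \<alpha>"
    using z \<alpha> by (auto simp: zero_sequence_def)
  have "\<forall>\<^sub>F w in at \<alpha>. B w \<noteq> 0 \<and> w \<in> unit_disk"
    using \<alpha> \<beta> by (intro non_zero_neighbour_alt[OF B]) auto
  then have "\<forall>\<^sub>F w in at \<alpha>. B w \<noteq> 0" by (rule eventually_mono) simp
  then have "\<exists>\<^sub>F w in at \<alpha>. B w \<noteq> 0"
    by (intro eventually_frequently) auto
  then have "zorder B \<alpha> > 0 \<longleftrightarrow> B \<alpha> = 0" using \<alpha> by (intro zorder_pos_iff[OF B]) auto
  moreover have "card {n. z n = \<alpha>} > 0 \<longleftrightarrow> \<alpha> \<in> range z"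
    using card(1) by (auto simp: card_gt_0_iff)
  ultimately show ?thesis using card(2) by linarith
qed

subsection \<open>Zeros in a strip cone\<close>

text \<open>In the coordinate \<open>s = \<xi> / (\<xi> - z)\<close> the disk is the half-plane \<open>Re s > 1/2\<close> and the strip cone is
  a strip which is not parallel to its boundary; so it approaches \<open>\<xi>\<close> nontangentially.\<close>

lemma strip_cone_nontangential:
  assumes \<xi>: "norm \<xi> = 1" and \<theta>: "0 < \<theta>" "\<theta> < pi"
  obtains r where "r > 0" "\<And>z. z \<in> strip_cone \<xi> \<theta> T\<^sub>1 T\<^sub>2 \<Longrightarrow> norm (\<xi> - z) < r \<Longrightarrow>
    sin \<theta> * norm (\<xi> - z) \<le> 1 - (norm z)\<^sup>2"
proof -
  define K where "K = max \<bar>half_curvature T\<^sub>1\<bar> \<bar>half_curvature T\<^sub>2\<bar>"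
  have K: "K \<ge> 0" by (simp add: K_def)
  have sin: "sin \<theta> > 0" using \<theta> by (rule sin_gt_zero)
  \<comment> \<open>This makes \<open>sin \<theta> / d\<close> exceed \<open>4 * K + 1\<close>, the
    total of the error terms collected at the end.\<close>
  define r where "r = sin \<theta> / (4 * K + 1)"
  have "r > 0" using K sin by (simp add: r_def)
  moreover have "sin \<theta> * norm (\<xi> - z) \<le> 1 - (norm z)\<^sup>2"
    if z: "z \<in> strip_cone \<xi> \<theta> T\<^sub>1 T\<^sub>2" and zr: "norm (\<xi> - z) < r" for z
  proof -
    define d where "d = norm (\<xi> - z)"
    define s where "s = \<xi> / (\<xi> - z)"
    \<comment> \<open>The rotated half-plane coordinate, in which the strip becomes vertical:
      \<open>\<bar>Re e\<bar> \<le> K\<close>.\<close>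
    define e where "e = cis \<theta> * s"
    have disk: "norm z < 1" using z by (simp add: strip_cone_def)
    then have d: "d > 0" using \<xi> by (auto simp: d_def)
    have x: "\<bar>Re e\<bar> \<le> K" using z by (auto simp: strip_cone_def e_def s_def K_def)
    have ne: "norm e = 1 / d" using \<xi> by (simp add: e_def s_def norm_mult norm_divide d_def)
    have "s = cis (- \<theta>) * e" by (simp add: e_def cis_mult flip: mult.assoc)
    then have Re_s: "Re s = Re e * cos \<theta> + Im e * sin \<theta>" by (simp add: mult.commute)
    have d2: "d\<^sup>2 * (2 * Re s - 1) = 1 - (norm z)\<^sup>2"
    proof -
      have "Re s = Re (\<xi> * cnj (\<xi> - z)) / d\<^sup>2"
        by (simp add: s_def d_def complex_div_cnj[of \<xi> "\<xi> - z"] Re_divide_of_real flip: of_real_power)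
      then have "d\<^sup>2 * (2 * Re s - 1) = 2 * Re (\<xi> * cnj (\<xi> - z)) - d\<^sup>2"
        using d by (simp add: field_simps)
      also have "\<dots> = (norm \<xi>)\<^sup>2 - (norm z)\<^sup>2"
        unfolding d_def cmod_power2 by (simp add: power2_eq_square algebra_simps)
      finally show ?thesis using \<xi> by simp
    qed
    have "1 - (norm z)\<^sup>2 > 0" using disk by (simp add: power_less_one_iff abs_square_less_1)
    then have s_gt: "2 * Re s > 1" using d2 d by (metis diff_gt_0_iff_gt zero_less_mult_pos zero_less_power)
    have cos: "\<bar>Re e * cos \<theta>\<bar> \<le> K"
      unfolding abs_mult using mult_mono[OF x abs_cos_le_one[of \<theta>]] K by simp
    have big: "sin \<theta> / d > 4 * K + 1"
      using zr d K sin by (simp add: r_def d_def[symmetric] field_simps)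
    have Ks: "K * sin \<theta> \<le> K" using K by (simp add: mult_left_le)
    have "\<bar>Im e\<bar> \<ge> 1 / d - K" using cmod_le[of e] x ne by linarith
    then have im: "\<bar>Im e\<bar> * sin \<theta> \<ge> sin \<theta> / d - K * sin \<theta>"
      using mult_right_mono[of "1 / d - K" "\<bar>Im e\<bar>" "sin \<theta>"] sin by (simp add: algebra_simps)
    \<comment> \<open>Near \<xi> the strip has two ends; on the one with \<open>Im e < 0\<close> the
      real part of \<open>s\<close> would be negative, outside the image of the disk.\<close>
    have "Im e \<ge> 0"
    proof (rule ccontr)
      assume "\<not> Im e \<ge> 0"
      then have "Im e * sin \<theta> = - (\<bar>Im e\<bar> * sin \<theta>)" by simp
      then show False using s_gt Re_s cos im big Ks K by linarith
    qed
    \<comment> \<open>From \<open>Re s \<ge> sin \<theta> / d - 2 * K\<close> one gets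
      \<open>2 * Re s - 1 \<ge> 2 * sin \<theta> / d - (4 * K + 1)\<close>, and \<open>big\<close>
      absorbs the last term.\<close>
    then have "2 * Re s - 1 \<ge> sin \<theta> / d" using Re_s cos im big Ks by (simp add: abs_le_iff)
    then have "d\<^sup>2 * (sin \<theta> / d) \<le> d\<^sup>2 * (2 * Re s - 1)" by (intro mult_left_mono) auto
    moreover have "d\<^sup>2 * (sin \<theta> / d) = sin \<theta> * d" using d by (simp add: power2_eq_square)
    ultimately show ?thesis unfolding d2 by (simp only: d_def)
  qed
  ultimately show ?thesis using that by blast
qed

lemma norm_one_minus_cnj_mult_le:
  assumes "norm \<xi> = 1" "norm z \<le> 1"
  shows "norm (1 - cnj z * w) \<le> norm (\<xi> - z) + norm (\<xi> - w)"
proof -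
  have "1 - cnj z * w = cnj (\<xi> - z) * \<xi> + cnj z * (\<xi> - w)"
    using complex_norm_square[of \<xi>] assms by (simp add: algebra_simps)
  also have "norm \<dots> \<le> norm (cnj (\<xi> - z) * \<xi>) + norm (cnj z * (\<xi> - w))"
    by (rule norm_triangle_ineq)
  also have "\<dots> \<le> norm (\<xi> - z) + norm (\<xi> - w)"
    unfolding norm_mult complex_mod_cnj using assms by (simp add: mult_left_le_one_le)
  finally show ?thesis .
qed

text \<open>The bound on \<rho> gives \<open>norm (z - w) \<le> \<delta> * (norm (\<xi> - z) + norm
  (\<xi> - w))\<close>; the triangle inequality then solves for
  \<open>norm (\<xi> - z)\<close>.\<close>

lemma dist_boundary_comparable:
  assumes \<xi>: "norm \<xi> = 1" and z: "norm z < 1" and w: "norm w < 1"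
    and \<delta>: "pseudo_hyperbolic_dist z w \<le> \<delta>" "\<delta> < 1"
  shows "norm (\<xi> - z) \<le> (1 + \<delta>) / (1 - \<delta>) * norm (\<xi> - w)"
proof -
  have nz: "norm (1 - cnj z * w) > 0" using one_minus_mult_nz[of z w] z w by simp
  have \<delta>0: "\<delta> \<ge> 0" using \<delta>(1) by (auto simp: pseudo_hyperbolic_dist_def intro: order_trans[rotated])
  have "norm (z - w) \<le> \<delta> * norm (1 - cnj z * w)"
    using \<delta>(1) nz by (simp add: pseudo_hyperbolic_dist_def norm_divide divide_le_eq)
  also have "\<dots> \<le> \<delta> * (norm (\<xi> - z) + norm (\<xi> - w))"
    using norm_one_minus_cnj_mult_le[OF \<xi>] z \<delta>0 by (intro mult_left_mono) auto
  finally have "norm (\<xi> - z) \<le> norm (\<xi> - w) + \<delta> * (norm (\<xi> - z) + norm (\<xi> - w))"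
    using norm_triangle_ineq[of "\<xi> - w" "w - z"] by (simp add: norm_minus_commute)
  then show ?thesis using \<delta>(2) by (simp add: field_simps)
qed

text \<open>In the formula for \<open>1 - \<rho>\<^sup>2\<close>, with \<open>x\<close> and
  \<open>y\<close> the distances to \<xi>, the numerator is at least
  \<open>c\<^sup>2 * x * y\<close> and the denominator at most \<open>(2 * x)\<^sup>2\<close>; the
  quotient is controlled by \<open>y / x \<ge> 1 / Q\<close>.\<close>

lemma pseudo_hyperbolic_nontangential:
  assumes \<xi>: "norm \<xi> = 1" and z: "norm z < 1" and w: "norm w < 1"
    and c: "0 < c" "c * norm (\<xi> - z) \<le> 1 - (norm z)\<^sup>2" "c * norm (\<xi> - w) \<le> 1 - (norm w)\<^sup>2"
    and Q: "norm (\<xi> - w) \<le> norm (\<xi> - z)" "norm (\<xi> - z) \<le> Q * norm (\<xi> - w)"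
  shows "(pseudo_hyperbolic_dist z w)\<^sup>2 \<le> 1 - c\<^sup>2 / (4 * Q)"
proof -
  define x y where "x = norm (\<xi> - z)" and "y = norm (\<xi> - w)"
  have pos: "x > 0" "y > 0" using \<xi> z w by (auto simp: x_def y_def)
  have xy: "y \<le> x" "x \<le> Q * y" using Q by (simp_all add: x_def y_def)
  have "Q > 0" using pos xy by (smt (verit) mult_nonneg_nonpos2 mult.commute)
  have nz: "norm (1 - cnj z * w) > 0" using one_minus_mult_nz[of z w] z w by simp
  have "norm (1 - cnj z * w) \<le> 2 * x"
    using norm_one_minus_cnj_mult_le[OF \<xi>, of z w] z xy by (simp add: x_def y_def)
  then have "(norm (1 - cnj z * w))\<^sup>2 \<le> (2 * x)\<^sup>2" by (intro power_mono) auto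
  moreover have prod_le: "(c * x) * (c * y) \<le> (1 - (norm z)\<^sup>2) * (1 - (norm w)\<^sup>2)"
    using c pos by (intro mult_mono) (auto simp: x_def y_def power_le_one less_imp_le z)
  moreover have "0 \<le> (1 - (norm z)\<^sup>2) * (1 - (norm w)\<^sup>2)"
    using c(1) pos by (intro order_trans[OF _ prod_le]) simp
  ultimately have "(c * x) * (c * y) / (2 * x)\<^sup>2 \<le>
      (1 - (norm z)\<^sup>2) * (1 - (norm w)\<^sup>2) / (norm (1 - cnj z * w))\<^sup>2"
    using nz by (intro frac_le) (simp_all only: zero_less_power)
  moreover have "c\<^sup>2 / (4 * Q) \<le> (c * x) * (c * y) / (2 * x)\<^sup>2"
  proof -
    have "c\<^sup>2 * x \<le> c\<^sup>2 * (Q * y)" using xy by (intro mult_left_mono) auto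
    then show ?thesis using \<open>Q > 0\<close> pos by (simp add: power2_eq_square field_simps)
  qed
  ultimately show ?thesis using pseudo_hyperbolic_sq[of z w] z w by simp
qed

section \<open>Choice of a lacunary subsequence\<close>

text \<open>From \<open>n\<close> one jumps to the first index where \<open>d\<close> has dropped by
  the factor 17. Its predecessor has not, so the single-step ratio \<open>C\<close> limits the drop
  to \<open>17 * C\<close>.\<close>

lemma lacunary_subsequence:
  fixes d :: "nat \<Rightarrow> real"
  assumes d: "\<And>n. 0 < d n" "decseq d" "d \<longlonglongrightarrow> 0" and C: "\<And>n. d n \<le> C * d (Suc n)"
  obtains m where "\<And>k. N \<le> m k" "\<And>k. 17 * d (m (Suc k)) \<le> d (m k)"
    "\<And>k. d (m k) \<le> 17 * C * d (m (Suc k))"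
proof -
  have ex: "\<exists>n'. n < n' \<and> 17 * d n' \<le> d n \<and> d n \<le> 17 * C * d n'" for n
  proof -
    have "\<exists>n'. 17 * d n' \<le> d n"
    proof -
      have "\<forall>\<^sub>F k in sequentially. d k < d n / 17" using d(1)[of n] by (intro order_tendstoD(2)[OF d(3)]) simp
      then obtain k where "d k < d n / 17" by (auto simp: eventually_sequentially)
      then show ?thesis by (intro exI[of _ k]) simp
    qed
    then obtain n' where n': "17 * d n' \<le> d n" "\<And>k. k < n' \<Longrightarrow> \<not> 17 * d k \<le> d n"
      using exists_least_iff[of "\<lambda>n'. 17 * d n' \<le> d n"] by auto
    have lt: "n < n'"
    proof (rule ccontr)
      assume "\<not> n < n'"
      then have "d n \<le> d n'" using d(2) by (simp add: decseq_def)
      then show False using n'(1) d(1)[of n'] by simp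
    qed
    then obtain k where k: "n' = Suc k" by (cases n') auto
    have "d n \<le> 17 * d k" using n'(2)[of k] k by simp
    also have "\<dots> \<le> 17 * C * d n'" using C[of k] k by simp
    finally show ?thesis using lt n'(1) by blast
  qed
  then obtain f where f: "\<And>n. n < f n" "\<And>n. 17 * d (f n) \<le> d n" "\<And>n. d n \<le> 17 * C * d (f n)"
    by metis
  show ?thesis
  proof (rule that[of "\<lambda>k. (f ^^ k) N"])
    show "N \<le> (f ^^ k) N" for k
      by (induction k) (auto intro: less_imp_le[OF le_less_trans[OF _ f(1)]])
  qed (use f in simp_all)
qed

theorem theorem2p9:
  fixes B :: "complex \<Rightarrow> complex"
  assumes "B \<in> H_SC"
  shows "\<exists>b. blaschke_factor b B \<and> interpolating_blaschke_product b \<and> one_component b"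
proof -
  obtain z \<xi> \<theta> T\<^sub>1 T\<^sub>2 \<delta> where BB: "blaschke_product B" and z: "zero_sequence B z"
    and \<xi>: "norm \<xi> = 1" and \<theta>: "0 < \<theta>" "\<theta> < pi"
    and cone: "range z \<subseteq> strip_cone \<xi> \<theta> T\<^sub>1 T\<^sub>2"
    and dec: "decseq (\<lambda>n. norm (\<xi> - z n))" "(\<lambda>n. norm (\<xi> - z n)) \<longlonglongrightarrow> 0"
    and \<delta>: "0 < \<delta>" "\<delta> < 1" "\<And>n. pseudo_hyperbolic_dist (z n) (z (Suc n)) \<le> \<delta>"
    using assms unfolding H_SC_def by blast
  obtain c m I a where c: "norm c = 1" and I: "blaschke_zeros I a"
    and B: "\<And>w. w \<in> unit_disk \<Longrightarrow> B w = c * w ^ m * blaschke_prod I a w"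
    using BB unfolding blaschke_product_def blaschke_zeros_def blaschke_prod_def by blast
  have hol: "B holomorphic_on unit_disk"
    using BB by (simp add: blaschke_product_def inner_function_def H_infinity_def)
  have zdisk: "norm (z n) < 1" for n
    using z by (simp add: zero_sequence_def image_subset_iff)
  define d where "d n = norm (\<xi> - z n)" for n
  have d: "d n > 0" for n using \<xi> zdisk[of n] by (auto simp: d_def)
  \<comment> \<open>Countably many zeros cannot fill the disk, so \<open>B\<close> is nonzero at
    some \<beta>, as the zero criterion requires.\<close>
  have "uncountable (unit_disk - insert 0 (a ` I))"
    by (intro uncountable_minus_countable uncountable_ball) auto
  then obtain \<beta> where "\<beta> \<in> unit_disk - insert 0 (a ` I)"
    by (metis countable_empty ex_in_conv)
  then have \<beta>: "\<beta> \<in> unit_disk" "B \<beta> \<noteq> 0"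
    using blaschke_prod_nonzero[OF I, of \<beta>] c by (auto simp: B)
  note zeros = mem_zero_sequence_iff[OF z hol \<beta>]
  \<comment> \<open>Each \<open>a n\<close> is a zero of \<open>B\<close>, hence some
    \<open>z k\<close>. Only finitely many \<open>z k\<close> stay away from \<xi>, and each value
    occurs finitely often among the \<open>a n\<close>.\<close>
  have acc: "finite {n\<in>I. \<epsilon> \<le> norm (\<xi> - a n)}" if \<epsilon>: "\<epsilon> > 0" for \<epsilon>
  proof -
    obtain K where K: "\<And>k. k \<ge> K \<Longrightarrow> d k < \<epsilon>"
      using order_tendstoD(2)[OF dec(2) \<epsilon>] by (auto simp: eventually_sequentially d_def)
    have "{n\<in>I. \<epsilon> \<le> norm (\<xi> - a n)} \<subseteq> (\<Union>\<alpha>\<in>z ` {..<K}. {n\<in>I. a n = \<alpha>})"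
    proof
      fix n assume n: "n \<in> {n\<in>I. \<epsilon> \<le> norm (\<xi> - a n)}"
      have "blaschke_prod I a (a n) = 0"
      proof -
        have "a n \<in> unit_disk" using blaschke_zerosD[OF I, of n] n by auto
        moreover have "I = {n} \<union> (I - {n})" using n by auto
        ultimately show ?thesis
          using blaschke_prod_Un[of "{n}" "I - {n}" a "a n"] I
          by (simp add: blaschke_prod_finite blaschke_term_def)
      qed
      then have "a n \<in> range z"
        using zeros[of "a n"] B[of "a n"] blaschke_zerosD[OF I, of n] n by auto
      then obtain k where k: "a n = z k" by auto
      then have "\<epsilon> \<le> d k" using n by (simp add: d_def)
      then have "k < K" using K[of k] by force
      then show "n \<in> (\<Union>\<alpha>\<in>z ` {..<K}. {n\<in>I. a n = \<alpha>})" using n k by auto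
    qed
    moreover have "finite (\<Union>\<alpha>\<in>z ` {..<K}. {n\<in>I. a n = \<alpha>})"
      using finite_blaschke_zeros_eq[OF I] zdisk by auto
    ultimately show ?thesis by (rule finite_subset)
  qed
  obtain r where r: "r > 0" "\<And>w. w \<in> strip_cone \<xi> \<theta> T\<^sub>1 T\<^sub>2 \<Longrightarrow> norm (\<xi> - w) < r \<Longrightarrow>
      sin \<theta> * norm (\<xi> - w) \<le> 1 - (norm w)\<^sup>2"
    using strip_cone_nontangential[OF \<xi> \<theta>] by blast
  \<comment> \<open>The bound \<open>r\<close> gives access to the nontangential estimate; the bound
    1 excludes the origin, whose zero sits in \<open>w ^ m\<close> and not in
    \<open>I\<close>.\<close>
  obtain N where N: "\<And>n. n \<ge> N \<Longrightarrow> d n < min r 1"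
    using order_tendstoD(2)[OF dec(2), of "min r 1"] r(1) by (auto simp: eventually_sequentially d_def)
  define C where "C = (1 + \<delta>) / (1 - \<delta>)"
  have C1: "C \<ge> 1" using \<delta> by (simp add: C_def)
  have dC: "d n \<le> C * d (Suc n)" for n
    unfolding d_def C_def by (intro dist_boundary_comparable \<xi> zdisk \<delta>)
  obtain \<mu> where \<mu>: "\<And>k. N \<le> \<mu> k" "\<And>k. 17 * d (\<mu> (Suc k)) \<le> d (\<mu> k)"
    "\<And>k. d (\<mu> k) \<le> 17 * C * d (\<mu> (Suc k))"
    using lacunary_subsequence[of d C N] d dec dC unfolding d_def by blast
  define x where "x k = z (\<mu> k)" for k
  have dx: "d (\<mu> k) = norm (\<xi> - x k)" for k by (simp add: x_def d_def)
  have xdisk: "norm (x k) < 1" for k using zdisk by (simp add: x_def)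
  \<comment> \<open>Strictly decreasing distances make \<open>x\<close> injective, so
    \<open>b\<close> has simple zeros even where \<open>B\<close> has multiple ones.\<close>
  have d_lt: "d (\<mu> (Suc k)) < d (\<mu> k)" for k using \<mu>(2)[of k] d[of "\<mu> (Suc k)"] by simp
  then have "strict_mono (\<lambda>k. - d (\<mu> k))" by (simp add: strict_mono_Suc_iff)
  then have "inj (\<lambda>k. - d (\<mu> k))" by (rule strict_mono_imp_inj_on)
  then have injx: "inj x" unfolding dx by (auto simp: inj_def)
  have "\<exists>i\<in>I. a i = x k" for k
  proof -
    have "x k \<noteq> 0" using N[OF \<mu>(1)[of k]] \<xi> by (auto simp: dx)
    moreover have "B (x k) = 0" using zeros[of "x k"] xdisk[of k] by (auto simp: x_def)
    ultimately have "blaschke_prod I a (x k) = 0" using B[of "x k"] xdisk[of k] c by auto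
    then have "x k \<in> a ` I" using blaschke_prod_nonzero[OF I, of "x k"] xdisk[of k] by auto
    then show ?thesis by force
  qed
  \<comment> \<open>One index of \<open>I\<close> is selected for each chosen zero; further copies
    of that zero stay in the cofactor.\<close>
  then obtain \<iota> where \<iota>: "\<And>k. \<iota> k \<in> I" "\<And>k. a (\<iota> k) = x k" by metis
  have a\<iota>: "(\<lambda>k. a (\<iota> k)) = x" using \<iota>(2) by auto
  define J where "J = range \<iota>"
  have JI: "J \<subseteq> I" using \<iota>(1) by (auto simp: J_def)
  have bij: "bij_betw \<iota> UNIV J"
    unfolding bij_betw_def J_def using injx \<iota>(2) by (metis injD injI)
  have J: "blaschke_zeros J a" and IJ: "blaschke_zeros (I - J) a"
    using blaschke_zeros_subset[OF I] JI by auto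
  have acc_sub: "finite {n\<in>S. \<epsilon> \<le> norm (\<xi> - a n)}" if "S \<subseteq> I" "\<epsilon> > 0" for S \<epsilon>
    by (rule finite_subset[OF _ acc[OF that(2)]]) (use that(1) in auto)
  define b where "b = blaschke_prod J a"
  have b: "blaschke_product b"
    by (rule blaschke_productI[OF J \<xi> norm_one, of _ 0]) (use acc_sub JI in \<open>auto simp: b_def\<close>)
  define g where "g w = c * w ^ m * blaschke_prod (I - J) a w" for w
  have "blaschke_product g"
    by (rule blaschke_productI[OF IJ \<xi> c, of _ m]) (use acc_sub[of "I - J"] in \<open>simp_all add: g_def\<close>)
  moreover have "B w = b w * g w" if w: "w \<in> unit_disk" for w
  proof -
    have "blaschke_prod I a w = blaschke_prod J a w * blaschke_prod (I - J) a w"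
      using blaschke_prod_Un[of J "I - J" a w] I JI w by (simp add: Un_absorb1)
    then show ?thesis using B[OF w] by (simp add: b_def g_def)
  qed
  ultimately have "blaschke_factor b B" using b unfolding blaschke_factor_def by blast
  moreover have "interpolating_blaschke_product b"
  proof -
    have "zero_sequence b x"
      using zero_sequence_blaschke_prod[OF J bij] injx by (simp add: a\<iota> b_def)
    moreover have "\<exists>f\<in>H_infinity. \<forall>n. f (x n) = w n" if "bounded (range w)" for w
      using xdisk \<mu>(2) that by (intro lacunary_interpolation[OF \<xi>]) (auto simp: dx)
    ultimately show ?thesis using b unfolding interpolating_blaschke_product_def by blast
  qed
  moreover have "one_component b"
  proof -
    \<comment> \<open>With \<open>c = sin \<theta>\<close> and \<open>Q = 17 * C\<close>, the
      distance estimate reads \<open>\<rho>\<^sup>2 \<le> 1 - q / 4\<close>.\<close>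
    define q where "q = (sin \<theta>)\<^sup>2 / (17 * C)"
    have q: "0 < q" "q \<le> 1"
    proof -
      have "(sin \<theta>)\<^sup>2 \<le> 1" by (simp add: abs_square_le_1)
      then show "0 < q" "q \<le> 1"
        using C1 sin_gt_zero[OF \<theta>] by (auto simp: q_def divide_le_eq)
    qed
    \<comment> \<open>Halving the gap \<open>q / 4\<close> to \<open>q / 8\<close> makes the
      inequality \<open>\<rho> < \<eta>\<close> strict while \<eta> stays below 1.\<close>
    define \<eta> where "\<eta> = sqrt (1 - q / 8)"
    have \<eta>: "0 < \<eta>" "\<eta> < 1" using q by (simp_all add: \<eta>_def)
    have "pseudo_hyperbolic_dist (a (\<iota> k)) (a (\<iota> (Suc k))) < \<eta>" for k
    proof -
      have nt: "sin \<theta> * norm (\<xi> - x k) \<le> 1 - (norm (x k))\<^sup>2" for k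
        using r(2)[of "x k"] cone N[OF \<mu>(1)[of k]] dx[of k] by (auto simp: x_def)
      have "(pseudo_hyperbolic_dist (x k) (x (Suc k)))\<^sup>2 \<le> 1 - (sin \<theta>)\<^sup>2 / (4 * (17 * C))"
        using d_lt[of k] \<mu>(3)[of k] sin_gt_zero[OF \<theta>]
        by (intro pseudo_hyperbolic_nontangential[OF \<xi>] xdisk nt) (auto simp: dx)
      also have "\<dots> = 1 - q / 4" by (simp add: q_def)
      also have "\<dots> < 1 - q / 8" using q by simp
      finally show ?thesis unfolding \<iota>(2) \<eta>_def by (rule real_less_rsqrt)
    qed
    then have "connected {w \<in> unit_disk. norm (b w) < \<eta>}"
      unfolding b_def by (intro connected_blaschke_level_set[OF J bij \<eta>])
    then show ?thesis
      using b \<eta> unfolding one_component_def blaschke_product_def by blast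
  qed
  ultimately show ?thesis by blast
qed

end
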